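(* Let $p\in(0,1)$ and let $\gamma'_p$ be the specification defined below. Let $l,r,L,R\in\mathbb{Z}$ with $l\le r$, $L<l-1$ and $r+1<R$, and set $n=\min\{l-L,R-r\}$ and $$s([l,r],[L,R])=\sup_{\substack{\omega',\eta'\in\Omega'\\ \omega'_{[L,R]}=\eta'_{[L,R]}}}\big|\gamma'_{p,[l,r]}(\omega'_{[l,r]}\mid\omega'_{[l,r]^c})-\gamma'_{p,[l,r]}(\omega'_{[l,r]}\mid\eta'_{[l,r]^c})\big|.$$ Then $$A_-\,b_-^{\,r-l+1}\,|a|^n\ \le\ s([l,r],[L,R])\ \le\ A_+\,b_+^{\,r-l+1}\,|a|^n,$$ where $a=\lambda_r/\lambda_{PF}\in(-1,0)$, $b_-=p$, $A_-=\tfrac16\sqrt{1-p}$, $b_+=\max\{p,\lambda_{PF}\}\in(0,1)$ and $A_+=24/(1-p)^2$.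
   Context: Fix $p\in(0,1)$. Let $\Omega=\{0,1\}^{\mathbb{Z}}$ with product $\sigma$-algebra $\mathscr F$, and $\mu_p=\mathrm{Ber}(p)^{\otimes\mathbb{Z}}$. Define $T:\Omega\to\Omega$ by $(T\omega)_i=\omega_i\big(1-(1-\omega_{i-1})(1-\omega_{i+1})\big)$. Let $\Omega'=T(\Omega)$ (configurations in which every occupied site has an occupied neighbour), $\mathscr F'=\mathscr F\cap\Omega'$, and $\mu'_p=\mu_p\circ T^{-1}$ (the TBF). For $\omega\in\Omega$ and $\Delta\subset\mathbb{Z}$, $\omega_\Delta$ is the restriction to $\Delta$ and $\xi_\Lambda\eta_{\Lambda^c}$ denotes concatenation. Transfer matrix: $Q$ is the $2\times2$ matrix indexed by $\{0,1\}$ with $Q(0,0)=1-p$, $Q(0,1)=Q(1,0)=\sqrt{p(1-p)}$, $Q(1,1)=0$; its eigenvalues are $\lambda_{PF}=\tfrac12\big(1-p+\sqrt{(1-p)(3p+1)}\big)\in(0,1)$ and $\lambda_r=\tfrac12\big(1-p-\sqrt{(1-p)(3p+1)}\big)\in(-\tfrac13,0)$. Geometry: for $A\subset\mathbb{Z}$, $\partial_+A=\{j\notin A: |j-i|=1\text{ for some }i\in A\}$ and $\bar A=A\cup\partial_+A$. For $\omega'\in\Omega'$ let $\Theta(\omega')=\{x:\omega'_x=1\}$, $\bar\Theta=\Theta\cup\partial_+\Theta$, and $\mathscr U(\omega')$ the set of connected components (maximal integer intervals, possibly infinite) of $\mathbb{Z}\setminus\bar\Theta$. For finite $\Lambda$,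 $\mathscr U_\Lambda(\omega')=\{U\in\mathscr U(\omega'):\mathrm{dist}(\bar\Lambda,U)\le1\}$, $V_-=[\min\bar\Lambda,+\infty)$, $V_+=(-\infty,\max\bar\Lambda]$. For $U\in\mathscr U_\Lambda(\omega')$ set $Z(U)=(1-p)^{-1}Q^{|U|+1}(0,0)$ if $U$ is finite; $Z(U)=(1-p)^{-1}\lambda_{PF}^{|U\cap V_-|}$ if $U$ is infinite with $\sup U<\infty$; $Z(U)=(1-p)^{-1}\lambda_{PF}^{|U\cap V_+|}$ if $U$ is infinite with $\inf U>-\infty$; and $Z(U)=(1-p)^{-1}D\,\lambda_{PF}^{|V_-\cap V_+|}$ if $U=\mathbb{Z}$, where $D=(1-p)(\lambda_{PF}+2p)/\lambda_{PF}^3$. The specification $\gamma'_p=(\gamma'_{p,\Lambda})_{\Lambda\Subset\mathbb{Z}}$ on $(\Omega',\mathscr F')$ (for which $\mu'_p$ is a Gibbs measure) is given by $\gamma'_{p,\Lambda}(\omega'_\Lambda\mid\omega'_{\Lambda^c})=Z_\Lambda(\omega'_{\Lambda^c})^{-1}p^{|\Theta\cap\bar\Lambda|}(1-p)^{|\partial_+\Theta\cap\bar\Lambda|}\prod_{U\in\mathscr U_\Lambda(\omega')}Z(U)$ with $\Theta=\Theta(\omega')$, where $Z_\Lambda(\omega'_{\Lambda^c})$ normalizes this to a probability distribution over $\{\xi_\Lambda:\xi_\Lambda\omega'_{\Lambda^c}\in\Omega'\}$. *)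

theory Defs
  imports Complex_Main
begin

text \<open>Configurations in {0,1}^Z are encoded as int => bool (True = occupied = 1).\<close>

definition T :: "(int \<Rightarrow> bool) \<Rightarrow> int \<Rightarrow> bool" where
  "T \<omega> i = (\<omega> i \<and> (\<omega> (i - 1) \<or> \<omega> (i + 1)))"

definition Omega' :: "(int \<Rightarrow> bool) set" where
  "Omega' = range T"

definition lambda_PF :: "real \<Rightarrow> real" where
  "lambda_PF p = (1 - p + sqrt ((1 - p) * (3 * p + 1))) / 2"

definition lambda_r :: "real \<Rightarrow> real" where
  "lambda_r p = (1 - p - sqrt ((1 - p) * (3 * p + 1))) / 2"

definition Dconst :: "real \<Rightarrow> real" where
  "Dconst p = (1 - p) * (lambda_PF p + 2 * p) / (lambda_PF p) ^ 3"

definition Qm :: "real \<Rightarrow> nat \<Rightarrow> nat \<Rightarrow> real" where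
  "Qm p i j = (if i = 0 \<and> j = 0 then 1 - p
               else if i = 1 \<and> j = 1 then 0
               else sqrt (p * (1 - p)))"

primrec Qpow :: "real \<Rightarrow> nat \<Rightarrow> nat \<Rightarrow> nat \<Rightarrow> real" where
  "Qpow p 0 i j = (if i = j then 1 else 0)"
| "Qpow p (Suc n) i j = (\<Sum>k\<in>{0::nat, 1}. Qm p i k * Qpow p n k j)"

definition bdry :: "int set \<Rightarrow> int set" where
  "bdry A = {j. j \<notin> A \<and> (\<exists>i\<in>A. \<bar>j - i\<bar> = 1)}"

definition clos :: "int set \<Rightarrow> int set" where
  "clos A = A \<union> bdry A"

definition Theta :: "(int \<Rightarrow> bool) \<Rightarrow> int set" where
  "Theta \<omega> = {x. \<omega> x}"

definition int_components :: "int set \<Rightarrow> int set set" where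
  "int_components S = {U. \<exists>x\<in>S. U = {y. {min x y..max x y} \<subseteq> S}}"

definition Ucomps :: "(int \<Rightarrow> bool) \<Rightarrow> int set set" where
  "Ucomps \<omega> = int_components (- clos (Theta \<omega>))"

definition Ucomps_Lam :: "int set \<Rightarrow> (int \<Rightarrow> bool) \<Rightarrow> int set set" where
  "Ucomps_Lam \<Lambda> \<omega> = {U \<in> Ucomps \<omega>. \<exists>i\<in>clos \<Lambda>. \<exists>j\<in>U. \<bar>i - j\<bar> \<le> 1}"

definition Vminus :: "int set \<Rightarrow> int set" where
  "Vminus \<Lambda> = {Min (clos \<Lambda>)..}"

definition Vplus :: "int set \<Rightarrow> int set" where
  "Vplus \<Lambda> = {..Max (clos \<Lambda>)}"

definition ZU :: "real \<Rightarrow> int set \<Rightarrow> int set \<Rightarrow> real" where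
  "ZU p \<Lambda> U =
     (if finite U then Qpow p (card U + 1) 0 0 / (1 - p)
      else if bdd_above U \<and> \<not> bdd_below U then lambda_PF p ^ card (U \<inter> Vminus \<Lambda>) / (1 - p)
      else if bdd_below U \<and> \<not> bdd_above U then lambda_PF p ^ card (U \<inter> Vplus \<Lambda>) / (1 - p)
      else if U = UNIV then Dconst p * lambda_PF p ^ card (Vminus \<Lambda> \<inter> Vplus \<Lambda>) / (1 - p)
      else 0)"

definition weight :: "real \<Rightarrow> int set \<Rightarrow> (int \<Rightarrow> bool) \<Rightarrow> real" where
  "weight p \<Lambda> \<omega> =
     p ^ card (Theta \<omega> \<inter> clos \<Lambda>) * (1 - p) ^ card (bdry (Theta \<omega>) \<inter> clos \<Lambda>)
     * (\<Prod>U\<in>Ucomps_Lam \<Lambda> \<omega>. ZU p \<Lambda> U)"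

definition concat :: "int set \<Rightarrow> (int \<Rightarrow> bool) \<Rightarrow> (int \<Rightarrow> bool) \<Rightarrow> int \<Rightarrow> bool" where
  "concat \<Lambda> \<xi> \<eta> = (\<lambda>x. if x \<in> \<Lambda> then \<xi> x else \<eta> x)"

definition admissible :: "int set \<Rightarrow> (int \<Rightarrow> bool) \<Rightarrow> (int \<Rightarrow> bool) set" where
  "admissible \<Lambda> \<eta> = {\<sigma> \<in> Omega'. \<forall>x. x \<notin> \<Lambda> \<longrightarrow> \<sigma> x = \<eta> x}"

definition Znorm :: "real \<Rightarrow> int set \<Rightarrow> (int \<Rightarrow> bool) \<Rightarrow> real" where
  "Znorm p \<Lambda> \<eta> = (\<Sum>\<sigma>\<in>admissible \<Lambda> \<eta>. weight p \<Lambda> \<sigma>)"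

definition gamma' :: "real \<Rightarrow> int set \<Rightarrow> (int \<Rightarrow> bool) \<Rightarrow> (int \<Rightarrow> bool) \<Rightarrow> real" where
  "gamma' p \<Lambda> \<xi> \<eta> =
     (if concat \<Lambda> \<xi> \<eta> \<in> Omega' then weight p \<Lambda> (concat \<Lambda> \<xi> \<eta>) / Znorm p \<Lambda> \<eta> else 0)"

definition s_osc :: "real \<Rightarrow> int \<Rightarrow> int \<Rightarrow> int \<Rightarrow> int \<Rightarrow> real" where
  "s_osc p l r L R = Sup {\<bar>gamma' p {l..r} \<omega> \<omega> - gamma' p {l..r} \<omega> \<eta>\<bar> | \<omega> \<eta>.
        \<omega> \<in> Omega' \<and> \<eta> \<in> Omega' \<and> (\<forall>x\<in>{L..R}. \<omega> x = \<eta> x)}"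

end

theory Submission
  imports Defs
begin

text \<open>With \<open>lam\<close> the Perron eigenvalue and \<open>a\<close> the ratio of the two eigenvalues of the transfer
  matrix, a gap of \<open>m\<close> sites has weight proportional to \<open>lam ^ m * (1 - a ^ (m + 2))\<close>. So the
  configuration outside the window enters its conditional weights only through the two adjacent
  sites or, if they are empty, through a parameter \<open>x = a ^ e\<close> on either side, where \<open>e\<close> is the
  distance to the nearest occupied site; infinite gaps correspond to \<open>x = 0\<close>. The weights are
  affine in each parameter, and the normalising constant is a product of one factor for each side,
  proportional to \<open>1 - x * a\<^sup>2\<close>. If two boundary conditions agree on \<open>{L..R}\<close>, then each of the two
  parameters is either the same for both or at most \<open>\<bar>a\<bar> ^ n\<close> in absolute value for both; the upper
  bound follows by comparing fractions of affine functions. The lower bound comes from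
  the fully occupied window next to occupied sites on one side and a gap on the other, comparing
  \<open>x = a ^ n\<close> with \<open>x = 0\<close>.\<close>

section \<open>The spectrum of the transfer matrix\<close>

text \<open>One formula covers every run of empty sites, so the scan needs no special cases. A run
  of m sites has weight (1 - p) Q^(m-1)(0,0), proportional to
  \<open>lam ^ (m - 1) * (1 - a ^ m)\<close>. For m >= 3 this is a gap with its two boundary sites;
  for m = 1, 2 there is no gap, but Q^0(0,0) = 1 and Q^1(0,0) = 1 - p still give the right weight.
  Infinite runs fit because \<open>Dconst p\<close> equals \<open>(1 - a) / lam\<close>. The factor
  \<open>b ^ (r - l + 1)\<close> arises because each site read multiplies the weight by at most
  \<open>b\<close>, up to a constant, while the normalising constant of a window with at least two
  sites does not depend on its length. The hypotheses give n >= 2, which keeps differing parameters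
  within \<open>a\<^sup>2\<close> and hence the denominators \<open>1 - x * a\<^sup>2\<close> above
  1 - a^4.\<close>

locale tbf =
  fixes p lam a :: real
  assumes p_pos: "0 < p" and p_less_1: "p < 1"
    and lam_def: "lam = lambda_PF p" and a_def: "a = lambda_r p / lambda_PF p"
begin

text \<open>\<open>lam * a\<close> is the second eigenvalue: \<open>lam_sq\<close> is the
  characteristic equation of \<open>Qm\<close> and \<open>lam_a\<close> its trace. The bounds
  \<open>lam < 1\<close> and \<open>a < 0\<close> come from \<open>1 - p < s < 1 + p\<close> for the
  square root \<open>s\<close>.\<close>

lemma lam_pos: "0 < lam" and lam_less_1: "lam < 1"
  and lam_sq: "lam\<^sup>2 = (1 - p) * lam + p * (1 - p)"
  and lam_a: "lam * (1 + a) = 1 - p"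
  and a_neg: "a < 0" and a_gt: "-1 < a"
proof -
  define s where "s = sqrt ((1 - p) * (3 * p + 1))"
  have s2: "s\<^sup>2 = (1 - p) * (3 * p + 1)"
    unfolding s_def using p_pos p_less_1 by simp
  have s0: "0 \<le> s" unfolding s_def using p_pos p_less_1 by simp
  have "(1 - p)\<^sup>2 < s\<^sup>2"
  proof -
    have "s\<^sup>2 - (1 - p)\<^sup>2 = 4 * (p * (1 - p))" unfolding s2 by (simp add: power2_eq_square algebra_simps)
    then show ?thesis using p_pos p_less_1 by (smt (verit) mult_pos_pos)
  qed
  then have sq: "1 - p < s" using s0 by (rule power2_less_imp_less)
  have "s\<^sup>2 < (1 + p)\<^sup>2"
  proof -
    have "(1 + p)\<^sup>2 - s\<^sup>2 = 4 * (p * p)" unfolding s2 by (simp add: power2_eq_square algebra_simps)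
    then show ?thesis using p_pos by (smt (verit) mult_pos_pos)
  qed
  then have s1: "s < 1 + p" by (rule power2_less_imp_less) (use p_pos in simp)
  have L: "lam = (1 - p + s) / 2" unfolding lam_def lambda_PF_def s_def ..
  have M: "lambda_r p = (1 - p - s) / 2" unfolding lambda_r_def s_def ..
  show l0: "0 < lam" and "lam < 1" unfolding L using sq s1 p_less_1 by auto
  have "4 * lam\<^sup>2 = (1 - p)\<^sup>2 + 2 * (1 - p) * s + s\<^sup>2" unfolding L by (simp add: power2_eq_square field_simps)
  also have "\<dots> = 4 * ((1 - p) * lam + p * (1 - p))" unfolding L s2 by (simp add: power2_eq_square field_simps)
  finally show "lam\<^sup>2 = (1 - p) * lam + p * (1 - p)" by simp
  have am: "lam * a = lambda_r p" unfolding a_def lam_def[symmetric] using l0 by simp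
  show la: "lam * (1 + a) = 1 - p" proof -
    have "lam * (1 + a) = lam + lambda_r p" using am by (simp add: distrib_left)
    then show ?thesis unfolding M L by (simp add: field_simps)
  qed
  have "lam * a < 0" unfolding am M using sq by simp
  then show "a < 0" using l0 by (simp add: mult_less_0_iff)
  have "0 < lam * (1 + a)" unfolding la using p_less_1 by simp
  then show "-1 < a" using l0 by (simp add: zero_less_mult_iff)
qed

text \<open>The product of the eigenvalues is the determinant of \<open>Qm\<close>. Together with
  \<open>lam_a\<close> it allows \<open>p * (1 - p)\<close> and \<open>1 - p\<close> to be
  eliminated in favour of \<open>lam\<close> and \<open>a\<close>.\<close>

lemma lam2_a: "lam\<^sup>2 * a = - (p * (1 - p))"
proof -
  have "lam\<^sup>2 * a = lam * (lam * (1 + a)) - lam\<^sup>2" by (simp add: power2_eq_square algebra_simps)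
  also have "\<dots> = - (p * (1 - p))" unfolding lam_a lam_sq by (simp add: algebra_simps)
  finally show ?thesis .
qed

lemma mu_sq: "(lam * a)\<^sup>2 = (1 - p) * (lam * a) + p * (1 - p)"
proof -
  have "(lam * a)\<^sup>2 = (lam * (1 + a)) * (lam * a) - lam\<^sup>2 * a" by (simp add: power2_eq_square algebra_simps)
  then show ?thesis unfolding lam_a lam2_a by simp
qed

lemma q_le_lam: "1 - p \<le> lam"
  using lam_a a_neg lam_pos by (smt (verit) mult_left_le)

lemma lam2_le: "lam\<^sup>2 \<le> 2 * (1 - p)"
proof -
  have "(1 - p) * (lam + p) \<le> (1 - p) * 2" using lam_less_1 p_less_1 by (intro mult_left_mono) auto
  then show ?thesis unfolding lam_sq by (simp add: algebra_simps)
qed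

lemma Qpow_Suc_Suc: "Qpow p (Suc (Suc n)) 0 0 = (1 - p) * Qpow p (Suc n) 0 0 + p * (1 - p) * Qpow p n 0 0"
proof -
  have "sqrt (p * (1 - p)) * sqrt (p * (1 - p)) = p * (1 - p)" using p_pos p_less_1 by simp
  then show ?thesis by (simp add: Qm_def mult.assoc[symmetric] del: real_sqrt_mult_self)
qed

text \<open>Powers of both eigenvalues satisfy the recursion \<open>Qpow_Suc_Suc\<close>; the
  coefficients are fixed by Q^0(0,0) = 1 and Q^1(0,0) = 1 - p.\<close>

lemma Qpow_eq: "Qpow p n 0 0 = (lam ^ n - a * (lam * a) ^ n) / (1 - a)"
proof (induction n rule: induct_nat_012)
  case 0
  then show ?case using a_neg by simp
next
  case 1
  have "(1 - p) * (1 - a) = lam - a * (lam * a)" unfolding lam_a[symmetric] by (simp add: algebra_simps)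
  then show ?case using a_neg by (simp add: Qm_def field_simps)
next
  case (ge2 n)
  have 1: "lam ^ Suc (Suc n) = (1 - p) * lam ^ Suc n + p * (1 - p) * lam ^ n"
  proof -
    have "lam ^ Suc (Suc n) = lam\<^sup>2 * lam ^ n" by (simp add: power2_eq_square)
    then show ?thesis unfolding lam_sq by (simp add: algebra_simps)
  qed
  have 2: "(lam * a) ^ Suc (Suc n) = (1 - p) * (lam * a) ^ Suc n + p * (1 - p) * (lam * a) ^ n"
  proof -
    have "(lam * a) ^ Suc (Suc n) = (lam * a)\<^sup>2 * (lam * a) ^ n" by (simp add: power2_eq_square)
    then show ?thesis unfolding mu_sq by (simp add: algebra_simps)
  qed
  show ?case unfolding Qpow_Suc_Suc ge2 unfolding 1 2 
    by (simp add: add_divide_distrib diff_divide_distrib algebra_simps del: power_Suc)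
qed

lemma Qpow_eq': "Qpow p n 0 0 = lam ^ n * (1 - a ^ Suc n) / (1 - a)"
  unfolding Qpow_eq by (simp add: power_mult_distrib algebra_simps)

lemma Dconst_eq: "Dconst p = (1 - a) / lam"
proof -
  have "(1 - p) * (lam + 2 * p) = lam\<^sup>2 * (1 - a)"
  proof -
    have "lam\<^sup>2 * (1 - a) = lam\<^sup>2 - lam\<^sup>2 * a" by (simp add: algebra_simps)
    then show ?thesis unfolding lam2_a unfolding lam_sq by (simp add: algebra_simps)
  qed
  then show ?thesis unfolding Dconst_def lam_def[symmetric] using lam_pos
    by (simp add: power2_eq_square power3_eq_cube)
qed

end

section \<open>A left-to-right scan of a window\<close>

text \<open>What a window sees immediately outside one of its ends: an occupied site whose outer
  neighbour is occupied (\<open>Paired\<close>) or empty (\<open>Single\<close>, so that the next site inwards must be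
  occupied), or an empty site; \<open>Gap x\<close> records \<open>x = a ^ e\<close> with \<open>e\<close> the distance to the nearest
  occupied site outwards, and \<open>x = 0\<close> if there is none.\<close>

datatype side = Paired | Single | Gap real

context tbf
begin

text \<open>Junction factor once nothing is left to read and the two sides are adjacent. An
  unsupported occupied site next to an empty one is forbidden. Two empty sites at distances
  \<open>e\<close> and \<open>f\<close> from their nearest occupied sites lie in a run of
  \<open>e + f\<close> sites, hence the product \<open>x * y\<close>.\<close>

fun ends :: "side \<Rightarrow> side \<Rightarrow> real" where
  "ends Paired (Gap x) = 1 - x"
| "ends Paired _ = 1"
| "ends Single (Gap x) = 0"
| "ends Single _ = 1"
| "ends (Gap y) Paired = 1 - y"
| "ends (Gap y) Single = 0"
| "ends (Gap y) (Gap x) = lam * (1 - a) * (1 - x * y) / (1 - p)"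

text \<open>Up to a factor depending only on the two sides, \<open>scan (ends R) s\<close> is the weight of a
  configuration in the window. A gap that has been entered with parameter \<open>x\<close> and continued over
  \<open>i\<close> further sites has weight proportional to \<open>lam ^ i * (1 - x * a ^ i)\<close>, by the spectral
  formula for the powers of the transfer matrix.\<close>

fun scan :: "(side \<Rightarrow> real) \<Rightarrow> side \<Rightarrow> bool list \<Rightarrow> real" where
  "scan E s [] = E s"
| "scan E Paired (b # xs) =
     (if b then p * scan E Paired xs else (1 - p) / (1 - a) * scan E (Gap a) xs)"
| "scan E Single (b # xs) = (if b then p * scan E Paired xs else 0)"
| "scan E (Gap x) (b # xs) =
     (if b then p * (1 - x) * scan E Single xs else lam * scan E (Gap (a * x)) xs)"

text \<open>The sum of the weights factorises as \<open>znorm s * znorm R\<close> for windows with at least two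
  sites: it counts Bernoulli configurations, and constraints from the two sides do not interact.\<close>

definition total :: "side \<Rightarrow> side \<Rightarrow> nat \<Rightarrow> real" where
  "total R s k = (\<Sum>xs | length xs = k. scan (ends R) s xs)"

fun znorm :: "side \<Rightarrow> real" where
  "znorm Paired = 1"
| "znorm Single = p"
| "znorm (Gap x) = lam\<^sup>2 * (1 - x * a\<^sup>2) / (1 - p)"

text \<open>Satisfied by every side of a configuration: an empty site is at distance at least 1 from
  any occupied one.\<close>

fun small_gap :: "side \<Rightarrow> bool" where
  "small_gap (Gap x) = (\<bar>x\<bar> \<le> - a)"
| "small_gap _ = True"

definition ratio :: "side \<Rightarrow> side \<Rightarrow> bool list \<Rightarrow> real" where
  "ratio s R xs = scan (ends R) s xs / total R s (length xs)"

lemma sum_lists_Suc: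
  fixes f :: "bool list \<Rightarrow> real"
  shows "(\<Sum>xs | length xs = Suc k. f xs) =
    (\<Sum>xs | length xs = k. f (True # xs)) + (\<Sum>xs | length xs = k. f (False # xs))"
proof -
  have fin: "finite {xs :: bool list. length xs = k}"
    using finite_lists_length_eq[of "UNIV :: bool set" k] by simp
  have eq: "{xs :: bool list. length xs = Suc k} =
      (#) True ` {xs. length xs = k} \<union> (#) False ` {xs. length xs = k}"
    by (auto simp: length_Suc_conv image_iff)
  show ?thesis unfolding eq using fin
    by (subst sum.union_disjoint) (auto simp: sum.reindex inj_on_def)
qed

lemma total_0: "total R s 0 = ends R s"
  unfolding total_def by simp

lemma total_Suc:
  "total R Paired (Suc k) = p * total R Paired k + (1 - p) / (1 - a) * total R (Gap a) k"
  "total R Single (Suc k) = p * total R Paired k"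
  "total R (Gap x) (Suc k) = p * (1 - x) * total R Single k + lam * total R (Gap (a * x)) k"
  unfolding total_def sum_lists_Suc by (simp_all add: sum_distrib_left)

text \<open>\<open>znorm\<close> is a fixed vector of the recursion \<open>total_Suc\<close>, so
  adding a site preserves the total. The second identity is affine in \<open>x\<close>; its two
  coefficients are the equation t^2 - t^3 = p^2 (1 - p) at the eigenvalues \<open>lam\<close> and
  \<open>lam * a\<close>.\<close>

lemma znorm_step:
  "p + (1 - p) / (1 - a) * znorm (Gap a) = 1"
  "p * (1 - x) * p + lam * znorm (Gap (a * x)) = znorm (Gap x)"
proof -
  have [simp]: "1 - a \<noteq> 0" "1 + a \<noteq> 0" "1 - p \<noteq> 0"
    using a_neg a_gt p_less_1 by auto
  have "p + (1 - p) / (1 - a) * znorm (Gap a) = p + lam\<^sup>2 * (1 - a * a\<^sup>2) / (1 - a)" using p_less_1 by simp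
  also have "1 - a * a\<^sup>2 = (1 - a) * (1 + a + a\<^sup>2)" by (simp add: power2_eq_square algebra_simps)
  also have "p + lam\<^sup>2 * ((1 - a) * (1 + a + a\<^sup>2)) / (1 - a) = p + lam\<^sup>2 * (1 + a + a\<^sup>2)" using a_neg by simp
  also have "\<dots> = p + (lam * (1 + a))\<^sup>2 - lam\<^sup>2 * a" by (simp add: power2_eq_square algebra_simps)
  also have "\<dots> = 1" unfolding lam_a lam2_a by (simp add: power2_eq_square algebra_simps)
  finally show "p + (1 - p) / (1 - a) * znorm (Gap a) = 1" .
  have 1: "lam\<^sup>2 - lam ^ 3 = p\<^sup>2 * (1 - p)"
  proof -
    have "lam ^ 3 = lam * ((1 - p) * lam + p * (1 - p))" unfolding lam_sq[symmetric] by (simp add: power3_eq_cube power2_eq_square)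
    also have "\<dots> = (1 - p) * lam\<^sup>2 + p * (1 - p) * lam" by (simp add: power2_eq_square algebra_simps)
    finally have "lam\<^sup>2 - lam ^ 3 = p * (lam\<^sup>2 - (1 - p) * lam)" by (simp add: algebra_simps)
    then show ?thesis unfolding lam_sq by (simp add: power2_eq_square)
  qed
  have 2: "(lam * a)\<^sup>2 - (lam * a) ^ 3 = p\<^sup>2 * (1 - p)"
  proof -
    have "(lam * a) ^ 3 = (lam * a) * ((1 - p) * (lam * a) + p * (1 - p))" unfolding mu_sq[symmetric] by (simp add: power3_eq_cube power2_eq_square)
    also have "\<dots> = (1 - p) * (lam * a)\<^sup>2 + p * (1 - p) * (lam * a)" by (simp add: power2_eq_square algebra_simps)
    finally have "(lam * a)\<^sup>2 - (lam * a) ^ 3 = p * ((lam * a)\<^sup>2 - (1 - p) * (lam * a))" by (simp add: algebra_simps)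
    then show ?thesis unfolding mu_sq by (simp add: power2_eq_square)
  qed
  have "lam\<^sup>2 * (1 - x * a\<^sup>2) - lam * (lam\<^sup>2 * (1 - a * x * a\<^sup>2)) = (lam\<^sup>2 - lam ^ 3) - x * ((lam * a)\<^sup>2 - (lam * a) ^ 3)"
    by (simp add: power2_eq_square power3_eq_cube algebra_simps)
  also have "\<dots> = p * (1 - x) * p * (1 - p)" unfolding 1 2 by (simp add: power2_eq_square algebra_simps)
  finally have "lam\<^sup>2 * (1 - x * a\<^sup>2) = p * (1 - x) * p * (1 - p) + lam * (lam\<^sup>2 * (1 - a * x * a\<^sup>2))" by simp
  then have "znorm (Gap x) = (p * (1 - x) * p * (1 - p) + lam * (lam\<^sup>2 * (1 - a * x * a\<^sup>2))) / (1 - p)" by simp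
  then show "p * (1 - x) * p + lam * znorm (Gap (a * x)) = znorm (Gap x)"
    using p_less_1 by (simp add: add_divide_distrib)
qed

text \<open>The left side is the total of a one-site window between a gap and a paired side: the
  site closes the gap or lengthens it.\<close>

lemma znorm_Gap_alt: "p * (1 - x) + lam * (1 - a * x) = znorm (Gap x)"
proof -
  have "(1 - p) * (p * (1 - x) + lam * (1 - a * x)) =
      ((1 - p) * lam + p * (1 - p)) - x * ((1 - p) * (lam * a) + p * (1 - p))"
    by (simp add: algebra_simps)
  also have "\<dots> = lam\<^sup>2 * (1 - x * a\<^sup>2)"
    unfolding lam_sq[symmetric] mu_sq[symmetric] by (simp add: power2_eq_square algebra_simps)
  finally show ?thesis using p_less_1 by (simp add: field_simps)
qed

lemma total_1_Paired_left: "total R Paired (Suc 0) = znorm R"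
proof (cases R)
  case Paired
  then show ?thesis using a_neg by (simp add: total_Suc total_0)
next
  case Single
  then show ?thesis by (simp add: total_Suc total_0)
next
  case (Gap y)
  have "total (Gap y) Paired (Suc 0) = p * (1 - y) + lam * (1 - a * y)"
    using a_neg p_less_1 by (simp add: total_Suc total_0)
  then show ?thesis unfolding Gap znorm_Gap_alt .
qed

lemma total_1_Paired_right: "total Paired s (Suc 0) = znorm s"
proof (cases s)
  case (Gap x)
  then show ?thesis using znorm_Gap_alt[of x] by (simp add: total_Suc total_0)
qed (use a_neg in \<open>simp_all add: total_Suc total_0\<close>)

lemma total_2_Gap: "total R (Gap x) (Suc (Suc 0)) = znorm (Gap x) * znorm R"
proof (cases R)
  case Paired
  then show ?thesis
    using znorm_step(2)[of x] by (simp only: total_Suc(2,3)[where k = "Suc 0"] total_1_Paired_right) simp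
next
  case Single
  then show ?thesis
    by (simp add: total_Suc total_0 znorm_Gap_alt[symmetric] del: znorm.simps(3)) (simp add: algebra_simps)
next
  case (Gap y)
  define c where "c = 1 - p"
  have c: "c \<noteq> 0" unfolding c_def using p_less_1 by simp
  \<comment> \<open>Between two gaps only the words 11 and 00 contribute, since exactly one occupied
    site would be isolated.\<close>
  have "total (Gap y) (Gap x) (Suc (Suc 0)) = p * (1 - x) * (p * (1 - y)) + lam * (lam * (lam * (1 - a) * (1 - a * (a * x) * y) / c))"
    by (simp add: total_Suc total_0 c_def)
  also have "\<dots> = (p * (1 - x) * (p * (1 - y)) * c\<^sup>2 + c * lam ^ 3 * (1 - a) * (1 - a\<^sup>2 * (x * y))) / c\<^sup>2"
    using c by (simp add: field_simps power2_eq_square power3_eq_cube)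
  also have "p * (1 - x) * (p * (1 - y)) * c\<^sup>2 + c * lam ^ 3 * (1 - a) * (1 - a\<^sup>2 * (x * y))
     = lam\<^sup>2 * (1 - x * a\<^sup>2) * (lam\<^sup>2 * (1 - y * a\<^sup>2))"
  proof -
    have 1: "p * c = - (lam\<^sup>2 * a)" unfolding c_def lam2_a by simp
    have 2: "c = lam * (1 + a)" unfolding c_def lam_a ..
    have "p * (1 - x) * (p * (1 - y)) * c\<^sup>2 = (1 - x) * (1 - y) * (p * c)\<^sup>2"
      by (simp add: power2_eq_square algebra_simps)
    then show ?thesis unfolding 1 unfolding 2 by (simp add: power2_eq_square power3_eq_cube algebra_simps)
  qed
  finally show ?thesis unfolding Gap by (simp add: c_def power2_eq_square)
qed

text \<open>The kinds of side are treated together because \<open>total_Suc\<close> passes between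
  them. The induction starts at two sites, the first length at which the product form holds for
  every pair of sides.\<close>

lemma total_eq_aux:
  "total R Paired (Suc (Suc k)) = znorm R \<and> total R Single (Suc (Suc k)) = p * znorm R
   \<and> (\<forall>x. total R (Gap x) (Suc (Suc k)) = znorm (Gap x) * znorm R)"
proof (induction k)
  case 0
  have "total R Paired (Suc (Suc 0)) = znorm R"
  proof (cases R)
    case Paired
    then show ?thesis using znorm_step(1) by (simp only: total_Suc(1)[of _ "Suc 0"] total_1_Paired_right) simp
  next
    case Single
    then show ?thesis using a_neg by (simp add: total_Suc total_0 field_simps)
  next
    case (Gap y)
    have "total (Gap y) Paired (Suc (Suc 0)) =
        p * znorm (Gap y) + lam\<^sup>2 * (1 - y * a\<^sup>2)"
      using a_neg p_less_1 unfolding total_Suc(1)[of _ "Suc 0"] total_1_Paired_left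
      by (simp add: total_Suc total_0 power2_eq_square mult_ac)
    also have "\<dots> = znorm (Gap y)"
      using p_less_1 by (simp add: field_simps)
    finally show ?thesis unfolding Gap .
  qed
  then show ?case by (simp add: total_2_Gap) (simp add: total_Suc(2) total_1_Paired_left)
next
  case (Suc k)
  have "total R Paired (Suc (Suc (Suc k))) = (p + (1 - p) / (1 - a) * znorm (Gap a)) * znorm R"
    unfolding total_Suc(1)[of _ "Suc (Suc k)"] using Suc by (simp add: algebra_simps)
  moreover have "total R (Gap x) (Suc (Suc (Suc k))) = (p * (1 - x) * p + lam * znorm (Gap (a * x))) * znorm R" for x
    unfolding total_Suc(3)[of _ _ "Suc (Suc k)"] using Suc by (simp add: algebra_simps)
  ultimately show ?case unfolding znorm_step using Suc by (simp add: total_Suc(2))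
qed


lemma total_eq:
  assumes "2 \<le> k \<or> k = 1 \<and> (s = Paired \<or> R = Paired)"
  shows "total R s k = znorm s * znorm R"
proof (cases "2 \<le> k")
  case True
  then obtain j where "k = Suc (Suc j)" by (metis add_2_eq_Suc le_Suc_ex)
  then show ?thesis using total_eq_aux[of R j] by (cases s) auto
next
  case False
  then show ?thesis using assms total_1_Paired_left[of R] total_1_Paired_right[of s] by auto
qed

section \<open>Bounds for the normalised scan\<close>

definition b :: real where "b = max p lam"
text \<open>Chosen so that \<open>(1 - p) / (1 - a) * G = lam\<close>: the weight of entering a gap
  then becomes an ordinary gap step. By \<open>G_eq\<close> it is also the prefactor of
  \<open>ends\<close> between two gaps.\<close>

definition G :: real where "G = (1 - a) / (1 + a)"

lemma b_half: "1 / 2 \<le> b"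
  unfolding b_def using q_le_lam by linarith

lemma b_ge: "p \<le> b" "lam \<le> b" unfolding b_def by auto

lemma b_pos: "0 < b" using p_pos b_ge by simp

lemma G_eq: "lam * (1 - a) / (1 - p) = G"
  unfolding lam_a[symmetric] G_def using lam_pos by simp

lemma G_ge: "1 - a \<le> G" "1 \<le> G"
proof -
  have "(1 - a) * (1 + a) \<le> (1 - a) * 1" using a_neg by (intro mult_left_mono) auto
  then show "1 - a \<le> G" unfolding G_def using a_gt by (simp add: field_simps)
  then show "1 \<le> G" using a_neg by simp
qed

lemma small_gap_step: "\<bar>x\<bar> \<le> - a \<Longrightarrow> \<bar>a * x\<bar> \<le> - a"
  using mult_left_mono[of "\<bar>x\<bar>" 1 "- a"] a_neg a_gt by (simp add: abs_mult)

fun gap_growth :: "side \<Rightarrow> real" where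
  "gap_growth (Gap x) = G"
| "gap_growth _ = 1"

text \<open>One step of the scan multiplies the bound \<open>gap_growth\<close> by at most
  \<open>b\<close>: entering a gap gives \<open>lam\<close> by the choice of \<open>G\<close>,
  staying gives \<open>lam\<close>, and leaving gives \<open>p * (1 - x)\<close> with
  \<open>1 - x \<le> G\<close>. The end function is arbitrary so that a final stretch of the word
  can be absorbed into it.\<close>

lemma scan_bounds:
  assumes "\<And>s. small_gap s \<Longrightarrow> 0 \<le> E s \<and> E s \<le> c * gap_growth s" "small_gap s"
  shows "0 \<le> scan E s xs \<and> scan E s xs \<le> c * gap_growth s * b ^ length xs"
  using assms(2)
proof (induction xs arbitrary: s)
  case Nil
  then show ?case using assms(1) by simp
next
  case (Cons t xs)
  define B where "B = b ^ length xs"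
  have B: "0 < B" unfolding B_def using b_pos by simp
  have c: "0 \<le> c" using assms(1)[of Paired] by simp
  note bl = b_ge
  have P: "0 \<le> scan E Paired xs" "scan E Paired xs \<le> c * B"
    using Cons.IH[of Paired] by (auto simp: B_def)
  have S: "0 \<le> scan E Single xs" "scan E Single xs \<le> c * B"
    using Cons.IH[of Single] by (auto simp: B_def)
  have Q: "0 \<le> scan E (Gap x) xs" "scan E (Gap x) xs \<le> c * G * B" if "\<bar>x\<bar> \<le> - a" for x
    using Cons.IH[of "Gap x"] that by (auto simp: B_def)
  have pb: "p * y \<le> c * (b * B)" if "0 \<le> y" "y \<le> c * B" for y
  proof -
    have "p * y \<le> b * (c * B)" using that bl p_pos by (intro mult_mono) auto
    then show ?thesis by (simp add: mult_ac)
  qed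
  show ?case
  proof (cases s)
    case Paired
    have "(1 - p) / (1 - a) * scan E (Gap a) xs \<le> (1 - p) / (1 - a) * (c * G * B)"
      using Q[of a] a_neg p_less_1 by (intro mult_left_mono) auto
    also have "\<dots> = lam * (c * B)"
      using a_neg a_gt unfolding lam_a[symmetric] G_def by simp
    also have "\<dots> \<le> b * (c * B)" using bl c B by (intro mult_right_mono) auto
    finally have "(1 - p) / (1 - a) * scan E (Gap a) xs \<le> c * (b * B)" by (simp add: mult_ac)
    moreover have "0 \<le> (1 - p) / (1 - a) * scan E (Gap a) xs" using Q(1)[of a] a_neg p_less_1 by simp
    ultimately show ?thesis using pb[OF P] P p_pos by (simp add: Paired B_def mult.assoc)
  next
    case Single
    then show ?thesis using pb[OF P] P p_pos b_pos c by (simp add: B_def mult.assoc)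
  next
    case (Gap x)
    then have x: "\<bar>x\<bar> \<le> - a" using Cons.prems by simp
    then have x1: "0 \<le> 1 - x" "1 - x \<le> G" using a_gt G_ge(1) by auto
    have "(1 - x) * (p * scan E Single xs) \<le> G * (c * (b * B))"
      by (rule mult_mono) (use x1 pb[OF S] S p_pos G_ge(2) in auto)
    moreover have "lam * scan E (Gap (a * x)) xs \<le> b * (c * G * B)"
      by (rule mult_mono) (use Q[OF small_gap_step[OF x]] bl lam_pos b_pos in auto)
    ultimately show ?thesis
      using Q(1)[OF small_gap_step[OF x]] lam_pos p_pos S x1 by (simp add: Gap B_def mult_ac)
  qed
qed

text \<open>The constant \<open>1 - a\<close> bounds \<open>1 - x * y\<close>, which exceeds 1 when
  the parameters have opposite signs.\<close>

lemma ends_bounds: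
  assumes "small_gap R" "small_gap s"
  shows "0 \<le> ends R s \<and> ends R s \<le> (case R of Gap y \<Rightarrow> 1 - a | _ \<Rightarrow> 1) * gap_growth s"
proof (cases s)
  case (Gap x)
  then have x: "\<bar>x\<bar> \<le> - a" using assms by simp
  show ?thesis
  proof (cases R)
    case (Gap y)
    then have y: "\<bar>y\<bar> \<le> - a" using assms by simp
    have "\<bar>x * y\<bar> \<le> (- a) * 1" unfolding abs_mult using x y a_gt by (intro mult_mono) auto
    then have xy: "0 \<le> 1 - x * y" "1 - x * y \<le> 1 - a" using a_gt by auto
    have "ends R s = G * (1 - x * y)" unfolding \<open>s = Gap x\<close> Gap G_eq[symmetric] by simp
    then show ?thesis using xy G_ge(2) mult_left_mono[OF xy(2), of G] unfolding \<open>s = Gap x\<close> Gap by (simp add: mult.commute)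
  qed (use x a_gt G_ge in \<open>auto simp: Gap\<close>)
next
  case Paired
  then show ?thesis using assms a_gt a_neg by (cases R) auto
next
  case Single
  then show ?thesis using assms a_gt a_neg by (cases R) auto
qed

lemma scan_append: "scan E s (xs @ ys) = scan (\<lambda>s. scan E s ys) s xs"
proof (induction xs arbitrary: s)
  case (Cons t xs)
  then show ?case by (cases s) simp_all
qed simp

text \<open>The parameter is used up at the first occupied site, or at the end. Each empty site
  before that multiplies the constant term by \<open>lam\<close> but the slope by
  \<open>lam * a\<close>, so the slope stays dominated.\<close>

lemma scan_left_affine:
  assumes "small_gap R"
  shows "\<exists>v. \<bar>v\<bar> \<le> scan (ends R) (Gap 0) xs \<and>
    (\<forall>x. scan (ends R) (Gap x) xs = scan (ends R) (Gap 0) xs - x * v)"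
proof (induction xs)
  case Nil
  show ?case
  proof (cases R)
    case Paired
    then show ?thesis by (intro exI[of _ 1]) simp
  next
    case Single
    then show ?thesis by (intro exI[of _ 0]) simp
  next
    case (Gap y)
    then have y: "\<bar>y\<bar> \<le> 1" using assms a_gt by simp
    have G: "0 < G" using G_ge(2) by linarith
    have e: "ends R (Gap x) = G * (1 - x * y)" for x unfolding Gap G_eq[symmetric] by simp
    have "\<bar>G * y\<bar> \<le> G * 1" unfolding abs_mult using G y by (intro mult_mono) auto
    then show ?thesis by (intro exI[of _ "G * y"]) (simp add: e right_diff_distrib mult_ac)
  qed
next
  case (Cons t xs)
  then obtain v where v: "\<bar>v\<bar> \<le> scan (ends R) (Gap 0) xs"
    "\<And>x. scan (ends R) (Gap x) xs = scan (ends R) (Gap 0) xs - x * v" by blast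
  have S: "0 \<le> scan (ends R) Single xs"
    using scan_bounds[of "ends R" _ Single] ends_bounds[OF assms] by auto
  show ?case
  proof (cases t)
    case True
    then show ?thesis using S p_pos
      by (intro exI[of _ "p * scan (ends R) Single xs"]) (simp add: algebra_simps)
  next
    case False
    have "\<bar>lam * (a * v)\<bar> \<le> lam * scan (ends R) (Gap 0) xs"
    proof -
      have "\<bar>a\<bar> * \<bar>v\<bar> \<le> 1 * scan (ends R) (Gap 0) xs" using v(1) a_neg a_gt by (intro mult_mono) auto
      then show ?thesis using lam_pos by (simp add: abs_mult)
    qed
    moreover have "lam * scan (ends R) (Gap (a * x)) xs = lam * scan (ends R) (Gap 0) xs - x * (lam * (a * v))" for x
      unfolding v(2)[of "a * x"] by (simp add: algebra_simps)
    ultimately show ?thesis using False by (intro exI[of _ "lam * (a * v)"]) simp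
  qed
qed

text \<open>Here the parameter enters only through \<open>ends\<close>, which is affine in it. The
  scan is linear in its end function with nonnegative coefficients on \<open>small_gap\<close>
  states, so domination of the slope is inherited.\<close>

lemma scan_right_affine:
  assumes "small_gap s"
  shows "\<exists>v. \<bar>v\<bar> \<le> scan (ends (Gap 0)) s xs \<and>
    (\<forall>y. scan (ends (Gap y)) s xs = scan (ends (Gap 0)) s xs - y * v)"
  using assms
proof (induction xs arbitrary: s)
  case Nil
  show ?case
  proof (cases s)
    case Paired
    then show ?thesis by (intro exI[of _ 1]) simp
  next
    case Single
    then show ?thesis by (intro exI[of _ 0]) simp
  next
    case (Gap x)
    then have x: "\<bar>x\<bar> \<le> 1" using Nil a_gt by simp
    have G: "0 < G" using G_ge(2) by linarith
    have e: "ends (Gap y) s = G * (1 - x * y)" for y unfolding Gap G_eq[symmetric] by simp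
    have "\<bar>G * x\<bar> \<le> G * 1" unfolding abs_mult using G x by (intro mult_mono) auto
    then show ?thesis by (intro exI[of _ "G * x"]) (simp add: e right_diff_distrib mult_ac)
  qed
next
  case (Cons t xs)
  have scale: "\<exists>v. \<bar>v\<bar> \<le> c * scan (ends (Gap 0)) s' xs \<and>
     (\<forall>y. c * scan (ends (Gap y)) s' xs = c * scan (ends (Gap 0)) s' xs - y * v)"
    if s': "small_gap s'" and c: "0 \<le> c" for s' c
  proof -
    obtain v where v: "\<bar>v\<bar> \<le> scan (ends (Gap 0)) s' xs"
      "\<And>y. scan (ends (Gap y)) s' xs = scan (ends (Gap 0)) s' xs - y * v"
      using Cons.IH[OF s'] by blast
    have "c * scan (ends (Gap y)) s' xs = c * scan (ends (Gap 0)) s' xs - y * (c * v)" for y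
      unfolding v(2)[of y] by (simp add: algebra_simps)
    moreover have "\<bar>c * v\<bar> \<le> c * scan (ends (Gap 0)) s' xs"
      using v(1) c by (simp add: abs_mult mult_left_mono)
    ultimately show ?thesis by blast
  qed
  show ?case
  proof (cases s)
    case Paired
    then show ?thesis using scale[of Paired p] scale[of "Gap a" "(1 - p) / (1 - a)"] p_pos p_less_1 a_neg
      by (cases t) simp_all
  next
    case Single
    then show ?thesis using scale[of Paired p] p_pos by (cases t) auto
  next
    case (Gap x)
    then have "\<bar>x\<bar> \<le> - a" using Cons.prems by simp
    then show ?thesis using scale[of Single "p * (1 - x)"] scale[of "Gap (a * x)" lam] p_pos lam_pos a_gt
        small_gap_step[of x]
      by (cases t) (simp_all add: Gap)
  qed
qed

end

section \<open>Effect of a changed gap parameter on normalised weights\<close>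

definition near :: "real \<Rightarrow> side \<Rightarrow> side \<Rightarrow> bool" where
  "near d s s' \<longleftrightarrow> s = s' \<or> (\<exists>x x'. s = Gap x \<and> s' = Gap x' \<and> \<bar>x\<bar> \<le> d \<and> \<bar>x'\<bar> \<le> d)"

context tbf begin

lemma a2_less_1: "a\<^sup>2 < 1"
  using a_neg a_gt by (simp add: abs_square_less_1)

text \<open>The difference has numerator \<open>(x' - x) * (v - a\<^sup>2 * u)\<close>, and
  \<open>d \<le> a\<^sup>2\<close> keeps both denominators above (1 - a^2)(1 + a^2). The factor 1 +
  a^2 from the numerator cancels against one of these.\<close>

lemma fraction_diff:
  assumes "\<bar>v\<bar> \<le> u" "\<bar>x\<bar> \<le> d" "\<bar>x'\<bar> \<le> d" "d \<le> a\<^sup>2"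
  shows "\<bar>(u - x * v) / (1 - x * a\<^sup>2) - (u - x' * v) / (1 - x' * a\<^sup>2)\<bar> \<le> 2 * d * u / (1 - a\<^sup>2)\<^sup>2"
proof -
  have low: "(1 - a\<^sup>2) * (1 + a\<^sup>2) \<le> 1 - y * a\<^sup>2" if "\<bar>y\<bar> \<le> d" for y
  proof -
    have "y * a\<^sup>2 \<le> a\<^sup>2 * a\<^sup>2" using that assms(4) by (intro mult_right_mono) auto
    then show ?thesis by (simp add: algebra_simps)
  qed
  define c where "c = (1 - a\<^sup>2) * (1 + a\<^sup>2)"
  have a1: "0 < 1 - a\<^sup>2" "1 \<le> 1 + a\<^sup>2" using a2_less_1 by auto
  then have c0: "0 < c" unfolding c_def by (smt (verit) mult_pos_pos)
  have X: "c \<le> 1 - x * a\<^sup>2" "c \<le> 1 - x' * a\<^sup>2" unfolding c_def using low assms by auto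
  then have X0: "0 < 1 - x * a\<^sup>2" "0 < 1 - x' * a\<^sup>2" using c0 by auto
  have u0: "0 \<le> u" using assms(1) by simp
  have "(u - x * v) / (1 - x * a\<^sup>2) - (u - x' * v) / (1 - x' * a\<^sup>2)
      = ((x' - x) * (v - a\<^sup>2 * u)) / ((1 - x * a\<^sup>2) * (1 - x' * a\<^sup>2))"
    using X0 by (simp add: field_simps)
  also have "\<bar>\<dots>\<bar> = \<bar>(x' - x) * (v - a\<^sup>2 * u)\<bar> / ((1 - x * a\<^sup>2) * (1 - x' * a\<^sup>2))"
    using X0 by (simp add: abs_mult)
  also have "\<dots> \<le> (2 * d * ((1 + a\<^sup>2) * u)) / (c * c)"
  proof (rule frac_le)
    have "\<bar>v - a\<^sup>2 * u\<bar> \<le> (1 + a\<^sup>2) * u"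
    proof -
      have "0 \<le> a\<^sup>2 * u" using u0 by simp
      then show ?thesis using assms(1) unfolding distrib_right by linarith
    qed
    then show "\<bar>(x' - x) * (v - a\<^sup>2 * u)\<bar> \<le> 2 * d * ((1 + a\<^sup>2) * u)"
      unfolding abs_mult using assms by (intro mult_mono) auto
    show "0 \<le> 2 * d * ((1 + a\<^sup>2) * u)" using assms u0 by simp
    show "0 < c * c" using c0 by simp
    show "c * c \<le> (1 - x * a\<^sup>2) * (1 - x' * a\<^sup>2)" using X c0 by (intro mult_mono) auto
  qed
  also have "\<dots> = 2 * d * u / ((1 - a\<^sup>2)\<^sup>2 * (1 + a\<^sup>2))"
    unfolding c_def using a1 by (simp add: power2_eq_square divide_simps)
  also have "\<dots> \<le> 2 * d * u / (1 - a\<^sup>2)\<^sup>2"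
  proof (rule divide_left_mono)
    have "(1 - a\<^sup>2)\<^sup>2 * 1 \<le> (1 - a\<^sup>2)\<^sup>2 * (1 + a\<^sup>2)" by (rule mult_left_mono) auto
    then show "(1 - a\<^sup>2)\<^sup>2 \<le> (1 - a\<^sup>2)\<^sup>2 * (1 + a\<^sup>2)" by simp
    show "0 \<le> 2 * d * u" using assms u0 by simp
    show "0 < (1 - a\<^sup>2)\<^sup>2 * (1 + a\<^sup>2) * (1 - a\<^sup>2)\<^sup>2" using a1 by (intro mult_pos_pos zero_less_power) linarith+
  qed
  finally show ?thesis .
qed

lemma znorm_pos: "small_gap s \<Longrightarrow> 0 < znorm s"
  and znorm_Gap_ge: "\<bar>x\<bar> \<le> - a \<Longrightarrow> lam \<le> znorm (Gap x)"
proof -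
  show *: "lam \<le> znorm (Gap x)" if "\<bar>x\<bar> \<le> - a" for x
  proof -
    have "x * a\<^sup>2 \<le> (- a) * 1" using that a2_less_1 a_neg by (intro mult_mono) auto
    then have "lam\<^sup>2 * (1 + a) \<le> lam\<^sup>2 * (1 - x * a\<^sup>2)" by (intro mult_left_mono) auto
    moreover have "lam\<^sup>2 * (1 + a) = lam * (1 - p)" unfolding lam_a[symmetric] by (simp add: power2_eq_square)
    ultimately show ?thesis using p_less_1 by (simp add: field_simps)
  qed
  show "small_gap s \<Longrightarrow> 0 < znorm s"
    using * lam_pos p_pos by (cases s) (auto simp del: znorm.simps(3) intro: less_le_trans)
qed

text \<open>Bound for the scan relative to \<open>znorm\<close> and the power of \<open>b\<close>:
  \<open>G\<close> is the gap growth, \<open>1 - a\<close> bounds \<open>ends\<close>,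
  \<open>lam\<close> bounds \<open>znorm\<close> of a gap from below, and 2 pays for one power of
  \<open>b\<close> (\<open>b_power_pred\<close>).\<close>

definition K :: real where "K = 2 * ((1 - a) / lam) * G"

lemma K_ge: "2 \<le> K" "2 * G \<le> K"
proof -
  define r where "r = (1 - a) / lam"
  have *: "1 \<le> r" unfolding r_def using lam_pos lam_less_1 a_neg by (simp add: field_simps)
  have "1 * G \<le> r * G" using * G_ge(2) by (intro mult_right_mono) auto
  then show "2 * G \<le> K" unfolding K_def r_def[symmetric] by auto
  then show "2 \<le> K" using G_ge(2) by simp
qed

text \<open>With \<open>1 - p = lam * (1 + a)\<close> all powers of \<open>1 - a\<close> cancel and
  \<open>4 / (lam * (1 + a))\<^sup>2\<close> remains. This is the origin of the denominator in the
  upper constant.\<close>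

lemma K_eq: "(1 - p) / lam\<^sup>2 * (2 * d * (K * B) / (1 - a\<^sup>2)\<^sup>2) = 4 / (1 - p)\<^sup>2 * B * d"
proof -
  have nz: "lam \<noteq> 0" "1 + a \<noteq> 0" "1 - a \<noteq> 0" using lam_pos a_neg a_gt by auto
  have f: "1 - a\<^sup>2 = (1 - a) * (1 + a)" by (simp add: power2_eq_square algebra_simps)
  show ?thesis unfolding K_def G_def f lam_a[symmetric] using nz
    by (simp add: power2_eq_square divide_simps)
qed

lemma b_power_pred: "0 < k \<Longrightarrow> b ^ (k - 1) \<le> 2 * b ^ k"
proof -
  assume "0 < k"
  then have "b ^ k = b * b ^ (k - 1)" by (simp add: power_eq_if)
  moreover have "1 / 2 * b ^ (k - 1) \<le> b * b ^ (k - 1)" using b_half b_pos by (intro mult_right_mono) auto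
  ultimately show ?thesis by simp
qed

lemma scan_le_left:
  assumes "small_gap R" "xs \<noteq> []"
  shows "scan (ends R) (Gap 0) xs \<le> K * znorm R * b ^ length xs"
proof -
  define B where "B = b ^ length xs"
  have B: "0 < B" unfolding B_def using b_pos by simp
  have u: "scan (ends R) (Gap 0) xs \<le> (case R of Gap y \<Rightarrow> 1 - a | _ \<Rightarrow> 1) * G * B"
    using scan_bounds[of "ends R" _ "Gap 0" xs] ends_bounds[OF assms(1)] a_neg by (auto simp: B_def)
  show ?thesis unfolding B_def[symmetric]
  proof (cases R)
    case Paired
    have "G * B \<le> K * B" using K_ge G_ge B by (intro mult_right_mono) auto
    then show "scan (ends R) (Gap 0) xs \<le> K * znorm R * B" using u Paired by simp
  next
    case Single
    \<comment> \<open>The last site must be occupied, which supplies the factor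
      \<open>p = znorm Single\<close> in place of one factor \<open>b\<close>.\<close>
    obtain ys t where xs: "xs = ys @ [t]" using assms(2) by (metis rev_exhaust)
    have "scan (ends R) (Gap 0) xs \<le> p * gap_growth (Gap 0) * b ^ length ys"
      unfolding xs scan_append
    proof (rule conjunct2[OF scan_bounds])
      fix s assume "small_gap s"
      then show "0 \<le> scan (ends R) s [t] \<and> scan (ends R) s [t] \<le> p * gap_growth s"
        using p_pos p_less_1 a_neg a_gt G_ge(1) lam_pos by (cases s; cases t) (auto simp: Single)
    qed (use a_neg in simp)
    also have "\<dots> = p * G * b ^ (length xs - 1)" by (simp add: xs)
    also have "\<dots> \<le> p * G * (2 * B)"
      unfolding B_def using b_power_pred[of "length xs"] assms(2) p_pos G_ge by (intro mult_left_mono) auto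
    also have "\<dots> = (2 * G) * (p * B)" by simp
    also have "\<dots> \<le> K * (p * B)" using K_ge p_pos B by (intro mult_right_mono) auto
    finally show "scan (ends R) (Gap 0) xs \<le> K * znorm R * B" by (simp add: Single)
  next
    case (Gap y)
    have "(1 - a) * G = K / 2 * lam" unfolding K_def using lam_pos by simp
    also have "\<dots> \<le> K * znorm R"
      by (rule mult_mono) (use K_ge znorm_Gap_ge[of y] assms Gap lam_pos in auto)
    finally have "(1 - a) * G * B \<le> K * znorm R * B" using B by (intro mult_right_mono) auto
    then show "scan (ends R) (Gap 0) xs \<le> K * znorm R * B" using u Gap by simp
  qed
qed

lemma scan_le_right:
  assumes "small_gap s" "xs \<noteq> []"
  shows "scan (ends (Gap 0)) s xs \<le> K * znorm s * b ^ length xs"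
proof -
  have E: "0 \<le> ends (Gap 0) t \<and> ends (Gap 0) t \<le> 1 * gap_growth t" if "small_gap t" for t
    using G_eq G_ge by (cases t) auto
  have u: "scan (ends (Gap 0)) t ys \<le> gap_growth t * b ^ length ys" if "small_gap t" for t ys
    using scan_bounds[of "ends (Gap 0)" 1 t ys] E that by auto
  show ?thesis
  proof (cases s)
    case Paired
    have "1 * b ^ length xs \<le> K * b ^ length xs" using K_ge b_pos by (intro mult_right_mono) auto
    then show ?thesis using u[of Paired xs] by (simp add: Paired)
  next
    case Single
    obtain t ys where xs: "xs = t # ys" using assms(2) by (cases xs) auto
    have "p * b ^ length ys \<le> p * (2 * b ^ length xs)"
      using b_power_pred[of "length xs"] p_pos by (simp add: xs)
    also have "\<dots> = 2 * (p * b ^ length xs)" by simp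
    also have "\<dots> \<le> K * (p * b ^ length xs)" using K_ge p_pos b_pos by (intro mult_right_mono) auto
    finally have *: "p * b ^ length ys \<le> K * p * b ^ length xs" by (simp add: mult.assoc)
    have "scan (ends (Gap 0)) s xs \<le> p * b ^ length ys"
      using u[of Paired ys] p_pos b_pos by (simp add: xs Single)
    then show ?thesis using * by (simp add: Single)
  next
    case (Gap x)
    have "G = K / 2 * (lam / (1 - a))" unfolding K_def using lam_pos a_neg by simp
    also have "\<dots> \<le> K * znorm s"
    proof (rule mult_mono)
      have "lam / (1 - a) \<le> lam / 1" using a_neg lam_pos by (intro divide_left_mono) auto
      then show "lam / (1 - a) \<le> znorm s" using znorm_Gap_ge[of x] assms Gap by auto
    qed (use K_ge lam_pos a_neg in auto)
    finally have "G * b ^ length xs \<le> K * znorm s * b ^ length xs" using b_pos by (intro mult_right_mono) auto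
    then show ?thesis using u[of s xs] assms by (simp add: Gap)
  qed
qed

text \<open>The norm \<open>z\<close> of the other side cancels against the bound on
  \<open>u\<close>, so the estimate is uniform in that side.\<close>

lemma affine_ratio_diff:
  assumes "\<bar>v\<bar> \<le> u" "u \<le> K * z * B" "0 < z" "\<bar>x\<bar> \<le> d" "\<bar>x'\<bar> \<le> d" "d \<le> a\<^sup>2"
  shows "\<bar>(u - x * v) / (znorm (Gap x) * z) - (u - x' * v) / (znorm (Gap x') * z)\<bar>
    \<le> 4 / (1 - p)\<^sup>2 * B * d"
proof -
  let ?c = "(1 - p) / (lam\<^sup>2 * z)"
  have c: "0 \<le> ?c" using p_less_1 assms(3) by simp
  have eq: "(u - y * v) / (znorm (Gap y) * z) = ?c * ((u - y * v) / (1 - y * a\<^sup>2))" for y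
    by (simp add: mult_ac)
  have "\<bar>(u - x * v) / (znorm (Gap x) * z) - (u - x' * v) / (znorm (Gap x') * z)\<bar>
      = ?c * \<bar>(u - x * v) / (1 - x * a\<^sup>2) - (u - x' * v) / (1 - x' * a\<^sup>2)\<bar>"
    unfolding eq right_diff_distrib[symmetric] abs_mult abs_of_nonneg[OF c] ..
  also have "\<dots> \<le> ?c * (2 * d * u / (1 - a\<^sup>2)\<^sup>2)"
    using fraction_diff[OF assms(1,4,5,6)] c by (rule mult_left_mono)
  also have "\<dots> \<le> ?c * (2 * d * (K * z * B) / (1 - a\<^sup>2)\<^sup>2)"
    using assms c by (intro mult_left_mono divide_right_mono) auto
  also have "\<dots> = (1 - p) / lam\<^sup>2 * (2 * d * (K * B) / (1 - a\<^sup>2)\<^sup>2)"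
    using assms(3) by simp
  also have "\<dots> = 4 / (1 - p)\<^sup>2 * B * d" by (rule K_eq)
  finally show ?thesis .
qed

text \<open>In a one-site window with no paired side the site is determined by the sides, and the
  product formula for the total fails.\<close>

lemma ratio_one_site:
  assumes "\<bar>x\<bar> \<le> - a" "R \<noteq> Paired" "small_gap R"
  shows "ratio (Gap x) R [t] = of_bool (t = (R = Single))"
proof -
  have x: "1 - x \<noteq> 0" using assms a_gt by auto
  show "ratio (Gap x) R [t] = of_bool (t = (R = Single))"
  proof (cases R)
    case Single
    then show ?thesis using x p_pos by (simp add: ratio_def total_Suc total_0)
  next
    case (Gap y)
    have "\<bar>a * x\<bar> * \<bar>y\<bar> \<le> 1 * \<bar>y\<bar>"
      using small_gap_step[OF assms(1)] a_gt by (intro mult_right_mono) auto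
    then have "a * x * y \<noteq> 1" using assms Gap a_gt by (auto simp flip: abs_mult)
    then show ?thesis using a_neg p_less_1 lam_pos Gap by (simp add: ratio_def total_Suc total_0)
  qed (use assms in simp)
qed

lemma ratio_Single_one_site: "\<bar>x\<bar> \<le> - a \<Longrightarrow> ratio Single (Gap x) [t] = of_bool t"
  using a_gt p_pos by (auto simp add: ratio_def total_Suc total_0)

lemma total_eq_cases:
  assumes "xs \<noteq> []"
  shows "total R s (length xs) = znorm s * znorm R \<or> (\<exists>t. xs = [t]) \<and> s \<noteq> Paired \<and> R \<noteq> Paired"
proof (cases "2 \<le> length xs")
  case False
  then have "length xs = 1" using assms by (simp add: not_le less_2_cases_iff)
  then show ?thesis using total_eq[of 1 s R] by (auto simp: length_Suc_conv)
qed (use total_eq in auto)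

context
  fixes d :: real
  assumes d: "d \<le> a\<^sup>2"
begin

lemma d_le: "\<bar>x\<bar> \<le> d \<Longrightarrow> \<bar>x\<bar> \<le> - a"
proof -
  have "a\<^sup>2 \<le> - a" using mult_left_mono[of "- a" 1 "- a"] a_neg a_gt by (simp add: power2_eq_square)
  then show "\<bar>x\<bar> \<le> d \<Longrightarrow> \<bar>x\<bar> \<le> - a" using d by simp
qed

lemma ratio_diff_left:
  assumes "\<bar>x\<bar> \<le> d" "\<bar>x'\<bar> \<le> d" "small_gap R" "xs \<noteq> []"
  shows "\<bar>ratio (Gap x) R xs - ratio (Gap x') R xs\<bar> \<le> 4 / (1 - p)\<^sup>2 * b ^ length xs * d"
proof (cases "(\<exists>t. xs = [t]) \<and> R \<noteq> Paired")
  case True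
  \<comment> \<open>The single site is forced, so both ratios are the same 0 or 1.\<close>
  then show ?thesis using ratio_one_site assms d_le b_pos by auto
next
  case False
  then have t: "total R (Gap y) (length xs) = znorm (Gap y) * znorm R" for y
    using total_eq_cases[OF assms(4)] by blast
  obtain v where v: "\<bar>v\<bar> \<le> scan (ends R) (Gap 0) xs"
    "\<And>x. scan (ends R) (Gap x) xs = scan (ends R) (Gap 0) xs - x * v"
    using scan_left_affine[OF assms(3)] by blast
  show ?thesis unfolding ratio_def t v(2)[of x] v(2)[of x']
    using affine_ratio_diff[OF v(1) scan_le_left[OF assms(3,4)] znorm_pos[OF assms(3)] assms(1,2) d] .
qed

lemma ratio_diff_right:
  assumes "\<bar>y\<bar> \<le> d" "\<bar>y'\<bar> \<le> d" "small_gap s" "xs \<noteq> []"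
  shows "\<bar>ratio s (Gap y) xs - ratio s (Gap y') xs\<bar> \<le> 4 / (1 - p)\<^sup>2 * b ^ length xs * d"
proof (cases "(\<exists>t. xs = [t]) \<and> s \<noteq> Paired")
  case True
  then show ?thesis using ratio_one_site ratio_Single_one_site assms d_le b_pos by (cases s) auto
next
  case False
  then have t: "total (Gap y) s (length xs) = znorm (Gap y) * znorm s" for y
    using total_eq_cases[OF assms(4), of "Gap y" s] by (auto simp: mult.commute)
  obtain v where v: "\<bar>v\<bar> \<le> scan (ends (Gap 0)) s xs"
    "\<And>y. scan (ends (Gap y)) s xs = scan (ends (Gap 0)) s xs - y * v"
    using scan_right_affine[OF assms(3)] by blast
  show ?thesis unfolding ratio_def t v(2)[of y] v(2)[of y']
    using affine_ratio_diff[OF v(1) scan_le_right[OF assms(3,4)] znorm_pos[OF assms(3)] assms(1,2) d] .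
qed

text \<open>The sides are changed one at a time, through the mixed pair \<open>s'\<close>,
  \<open>R\<close>.\<close>

lemma ratio_near:
  assumes "near d s s'" "near d R R'" "small_gap s'" "small_gap R" "xs \<noteq> []" "0 \<le> d"
  shows "\<bar>ratio s R xs - ratio s' R' xs\<bar> \<le> 24 / (1 - p)\<^sup>2 * b ^ length xs * d"
proof -
  let ?e = "4 / (1 - p)\<^sup>2 * b ^ length xs * d"
  have e: "0 \<le> ?e" using b_pos assms(6) by simp
  have "\<bar>ratio s R xs - ratio s' R xs\<bar> \<le> ?e"
    using assms(1) e ratio_diff_left[OF _ _ assms(4,5)] unfolding near_def by auto
  moreover have "\<bar>ratio s' R xs - ratio s' R' xs\<bar> \<le> ?e"
    using assms(2) e ratio_diff_right[OF _ _ assms(3,5)] unfolding near_def by auto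
  ultimately have "\<bar>ratio s R xs - ratio s' R' xs\<bar> \<le> 2 * ?e" by linarith
  \<comment> \<open>Two changes cost 8 / (1 - p)^2, relaxed here to the constant 24 of the
    theorem.\<close>
  also have "2 * ?e \<le> 6 * ?e" using e by linarith
  finally show ?thesis by simp
qed

end

section \<open>The fully occupied window\<close>

lemma scan_ones:
  "scan E Paired (replicate k True) = p ^ k * E Paired"
  "scan E Single (replicate k True) = p ^ k * (if k = 0 then E Single else E Paired)"
  "scan E (Gap x) (replicate (Suc k) True) = p ^ Suc k * (1 - x) * (if k = 0 then E Single else E Paired)"
proof -
  show 1: "scan E Paired (replicate k True) = p ^ k * E Paired" for k
    by (induction k) auto
  show 2: "scan E Single (replicate k True) = p ^ k * (if k = 0 then E Single else E Paired)" for k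
    by (cases k) (auto simp: 1)
  show "scan E (Gap x) (replicate (Suc k) True) = p ^ Suc k * (1 - x) * (if k = 0 then E Single else E Paired)"
    by (simp add: 2)
qed

text \<open>The paired side has norm 1 and makes the product formula valid for a one-site window
  too.\<close>

lemma ratio_ones:
  assumes "0 < k"
  shows "ratio (Gap x) Paired (replicate k True) = p ^ k * (1 - x) / znorm (Gap x)"
    and "ratio Paired (Gap x) (replicate k True) = p ^ k * (1 - x) / znorm (Gap x)"
proof -
  have t: "total Paired (Gap x) k = znorm (Gap x)" "total (Gap x) Paired k = znorm (Gap x)"
    using total_eq[of k "Gap x" Paired] total_eq[of k Paired "Gap x"] assms by (cases "2 \<le> k"; simp)+
  obtain j where "k = Suc j" using assms by (cases k) auto
  then show "ratio (Gap x) Paired (replicate k True) = p ^ k * (1 - x) / znorm (Gap x)"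
    unfolding ratio_def length_replicate t unfolding \<open>k = Suc j\<close> scan_ones(3) by simp
  show "ratio Paired (Gap x) (replicate k True) = p ^ k * (1 - x) / znorm (Gap x)"
    unfolding ratio_def using t by (simp add: scan_ones)
qed

text \<open>From \<open>lam2_le\<close>, \<open>lam ^ 3\<close> is at most 2 sqrt 2 (1 - p)^(3/2),
  and sqrt 2 is at most 3/2. The 1/6 of the lower constant comes from here.\<close>

lemma lam3_le: "2 * lam ^ 3 \<le> 6 * (1 - p) * sqrt (1 - p)"
proof -
  have "lam \<le> sqrt (2 * (1 - p))" using lam2_le real_le_rsqrt by auto
  then have "lam * lam\<^sup>2 \<le> sqrt (2 * (1 - p)) * (2 * (1 - p))"
    using lam2_le lam_pos p_less_1 by (intro mult_mono) auto
  also have "\<dots> = sqrt 2 * (2 * (1 - p) * sqrt (1 - p))" unfolding real_sqrt_mult[of 2] by simp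
  also have "\<dots> \<le> 3 / 2 * (2 * (1 - p) * sqrt (1 - p))"
  proof (rule mult_right_mono)
    show "sqrt 2 \<le> 3 / 2" by (rule real_le_lsqrt) (simp_all add: power2_eq_square)
  qed (use p_less_1 in auto)
  finally show ?thesis by (simp add: power2_eq_square power3_eq_cube algebra_simps)
qed

text \<open>With \<open>x = a ^ n\<close> the difference is computed exactly (\<open>eq\<close>).
  Then \<open>1 - a\<^sup>2 \<ge> 1 + a\<close> and \<open>1 - x * a\<^sup>2 \<le> 2\<close> leave
  the factor (1 - p)(1 + a) / (2 lam^2) = (1 - p)^2 / (2 lam^3), to which \<open>lam3_le\<close>
  applies.\<close>

lemma ones_diff:
  "sqrt (1 - p) / 6 * p ^ k * \<bar>a\<bar> ^ n
    \<le> \<bar>p ^ k * (1 - a ^ n) / znorm (Gap (a ^ n)) - p ^ k * (1 - 0) / znorm (Gap 0)\<bar>"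
proof -
  define x where "x = a ^ n"
  define s where "s = sqrt (1 - p)"
  have s: "0 < s" "s * s = 1 - p" unfolding s_def using p_less_1 by auto
  have ax: "\<bar>x\<bar> = \<bar>a\<bar> ^ n" unfolding x_def by (simp add: power_abs)
  have ax1: "\<bar>x\<bar> \<le> 1" unfolding ax using a_neg a_gt by (simp add: power_le_one)
  have "\<bar>x * a\<^sup>2\<bar> \<le> 1 * a\<^sup>2" unfolding abs_mult using ax1 by (intro mult_mono) auto
  then have X: "0 < 1 - x * a\<^sup>2" "1 - x * a\<^sup>2 \<le> 2" using a2_less_1 by auto
  have "p ^ k * (1 - x) / znorm (Gap x) - p ^ k * (1 - 0) / znorm (Gap 0)
      = (p ^ k * (1 - p) / lam\<^sup>2) * ((1 - x) / (1 - x * a\<^sup>2) - 1)"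
    using lam_pos p_less_1 X by (simp add: divide_simps) (simp add: algebra_simps)
  also have "(1 - x) / (1 - x * a\<^sup>2) - 1 = - (x * (1 - a\<^sup>2)) / (1 - x * a\<^sup>2)"
    using X by (simp add: divide_simps) (simp add: algebra_simps)
  also have "\<bar>(p ^ k * (1 - p) / lam\<^sup>2) * (- (x * (1 - a\<^sup>2)) / (1 - x * a\<^sup>2))\<bar>
      = (p ^ k * \<bar>x\<bar>) * ((1 - p) * (1 - a\<^sup>2) / (lam\<^sup>2 * (1 - x * a\<^sup>2)))"
    using X p_pos p_less_1 a2_less_1 by (simp add: abs_mult)
  finally have eq: "\<bar>p ^ k * (1 - x) / znorm (Gap x) - p ^ k * (1 - 0) / znorm (Gap 0)\<bar>
      = (p ^ k * \<bar>x\<bar>) * ((1 - p) * (1 - a\<^sup>2) / (lam\<^sup>2 * (1 - x * a\<^sup>2)))" .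
  have "s / 6 \<le> (1 - p) * (1 - p) / (2 * lam ^ 3)"
  proof -
    have "s * (2 * lam ^ 3) \<le> s * (6 * (1 - p) * s)" using lam3_le s unfolding s_def[symmetric] by (intro mult_left_mono) auto
    also have "\<dots> = 6 * ((1 - p) * (1 - p))" unfolding s(2)[symmetric] by (simp add: mult_ac)
    finally show ?thesis using lam_pos by (simp add: field_simps)
  qed
  also have "\<dots> = (1 - p) * (1 + a) / (lam\<^sup>2 * 2)"
  proof -
    have "(1 - p) * (1 - p) / (2 * lam ^ 3) = (1 - p) * (lam * (1 + a)) / (2 * lam ^ 3)" unfolding lam_a ..
    then show ?thesis using lam_pos by (simp add: power2_eq_square power3_eq_cube)
  qed
  also have "\<dots> \<le> (1 - p) * (1 - a\<^sup>2) / (lam\<^sup>2 * (1 - x * a\<^sup>2))"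
  proof (rule frac_le)
    have "(1 + a) * 1 \<le> (1 + a) * (1 - a)" using a_neg a_gt by (intro mult_left_mono) auto
    then have "1 + a \<le> 1 - a\<^sup>2" by (simp add: power2_eq_square algebra_simps)
    then show "(1 - p) * (1 + a) \<le> (1 - p) * (1 - a\<^sup>2)" using p_less_1 by simp
  qed (use p_less_1 a2_less_1 lam_pos X in auto)
  finally have "(p ^ k * \<bar>x\<bar>) * (s / 6) \<le> (p ^ k * \<bar>x\<bar>) * ((1 - p) * (1 - a\<^sup>2) / (lam\<^sup>2 * (1 - x * a\<^sup>2)))"
    using p_pos by (intro mult_left_mono) auto
  then show ?thesis unfolding x_def[symmetric] eq unfolding s_def ax by (simp add: mult_ac)
qed

end

section \<open>Gaps of a configuration\<close>

definition left_dist :: "(int \<Rightarrow> bool) \<Rightarrow> int \<Rightarrow> nat option" where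
  "left_dist \<sigma> A = (if \<exists>e. \<sigma> (A - int e) then Some (LEAST e. \<sigma> (A - int e)) else None)"

text \<open>The right side of a window is handled as the left side of the reflected configuration at
  the negated site.\<close>

definition mirror :: "(int \<Rightarrow> bool) \<Rightarrow> int \<Rightarrow> bool" where
  "mirror \<sigma> x = \<sigma> (- x)"

definition free :: "(int \<Rightarrow> bool) \<Rightarrow> int set" where
  "free \<sigma> = - clos (Theta \<sigma>)"

text \<open>The component of \<open>x\<close> in the form used by \<open>int_components\<close>;
  empty if \<open>x\<close> is not free.\<close>

definition gap_at :: "(int \<Rightarrow> bool) \<Rightarrow> int \<Rightarrow> int set" where
  "gap_at \<sigma> x = {y. {min x y..max x y} \<subseteq> free \<sigma>}"

lemma left_dist_eq_Some_iff: "left_dist \<sigma> A = Some e \<longleftrightarrow> \<sigma> (A - int e) \<and> (\<forall>j<e. \<not> \<sigma> (A - int j))"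
proof
  assume "left_dist \<sigma> A = Some e"
  then have ex: "\<exists>e. \<sigma> (A - int e)" and e: "e = (LEAST e. \<sigma> (A - int e))"
    unfolding left_dist_def by (auto split: if_splits)
  show "\<sigma> (A - int e) \<and> (\<forall>j<e. \<not> \<sigma> (A - int j))"
    unfolding e using LeastI_ex[OF ex] not_less_Least by blast
next
  assume *: "\<sigma> (A - int e) \<and> (\<forall>j<e. \<not> \<sigma> (A - int j))"
  then have "(LEAST e. \<sigma> (A - int e)) = e" by (intro Least_equality) (auto simp: not_less[symmetric])
  then show "left_dist \<sigma> A = Some e" unfolding left_dist_def using * by auto
qed

lemma left_dist_eq_None_iff: "left_dist \<sigma> A = None \<longleftrightarrow> (\<forall>z\<le>A. \<not> \<sigma> z)"
proof -
  have "(\<forall>e. \<not> \<sigma> (A - int e)) \<longleftrightarrow> (\<forall>z\<le>A. \<not> \<sigma> z)"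
  proof (intro iffI allI impI)
    fix z assume "\<forall>e. \<not> \<sigma> (A - int e)" "z \<le> A"
    then show "\<not> \<sigma> z" by (metis diff_diff_eq2 add_diff_cancel_left' zle_iff_zadd)
  qed simp
  then show ?thesis unfolding left_dist_def by auto
qed

lemma left_dist_SomeD:
  assumes "left_dist \<sigma> A = Some e"
  shows "\<sigma> (A - int e)" "\<And>z. A - int e < z \<Longrightarrow> z \<le> A \<Longrightarrow> \<not> \<sigma> z"
proof -
  have *: "\<sigma> (A - int e)" "\<And>j. j < e \<Longrightarrow> \<not> \<sigma> (A - int j)" using assms left_dist_eq_Some_iff by auto
  show "\<sigma> (A - int e)" by fact
  fix z assume "A - int e < z" "z \<le> A"
  then have "nat (A - z) < e" "z = A - int (nat (A - z))" by auto
  then show "\<not> \<sigma> z" using *(2) by metis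
qed

lemma left_dist_SomeI:
  assumes "\<sigma> (A - int e)" "\<And>z. A - int e < z \<Longrightarrow> z \<le> A \<Longrightarrow> \<not> \<sigma> z"
  shows "left_dist \<sigma> A = Some e"
  unfolding left_dist_eq_Some_iff using assms by auto

lemma left_dist_occ: "\<sigma> A \<Longrightarrow> left_dist \<sigma> A = Some 0"
  by (rule left_dist_SomeI) auto

lemma left_dist_step: "\<not> \<sigma> A \<Longrightarrow> left_dist \<sigma> A = map_option Suc (left_dist \<sigma> (A - 1))"
proof (cases "left_dist \<sigma> (A - 1)")
  case None
  assume "\<not> \<sigma> A"
  then have "left_dist \<sigma> A = None" using None unfolding left_dist_eq_None_iff
    by (metis linorder_not_le order_less_le zle_diff1_eq)
  then show ?thesis using None by simp
next
  case (Some e)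
  assume A: "\<not> \<sigma> A"
  have "left_dist \<sigma> A = Some (Suc e)"
  proof (rule left_dist_SomeI)
    show "\<sigma> (A - int (Suc e))" using left_dist_SomeD(1)[OF Some] by (simp add: algebra_simps)
    fix z assume "A - int (Suc e) < z" "z \<le> A"
    then show "\<not> \<sigma> z" using left_dist_SomeD(2)[OF Some, of z] A by (cases "z = A") auto
  qed
  then show ?thesis using Some by simp
qed

lemma free_iff: "x \<in> free \<sigma> \<longleftrightarrow> \<not> \<sigma> x \<and> \<not> \<sigma> (x - 1) \<and> \<not> \<sigma> (x + 1)"
proof -
  have "\<bar>x - i\<bar> = 1 \<longleftrightarrow> i = x - 1 \<or> i = x + 1" for i :: int by auto
  then show ?thesis unfolding free_def clos_def bdry_def Theta_def by auto
qed

lemma bdry_Theta_iff: "x \<in> bdry (Theta \<sigma>) \<longleftrightarrow> \<not> \<sigma> x \<and> (\<sigma> (x - 1) \<or> \<sigma> (x + 1))"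
proof -
  have "\<bar>x - i\<bar> = 1 \<longleftrightarrow> i = x - 1 \<or> i = x + 1" for i :: int by auto
  then show ?thesis unfolding bdry_def Theta_def by auto
qed

lemma free_mirror: "x \<in> free (mirror \<sigma>) \<longleftrightarrow> - x \<in> free \<sigma>"
proof -
  have "- x - 1 = - (x + 1)" "- x + 1 = - (x - 1)" by auto
  then show ?thesis unfolding free_iff mirror_def by metis
qed

lemma Ucomps_eq: "Ucomps \<sigma> = gap_at \<sigma> ` free \<sigma>"
  unfolding Ucomps_def int_components_def gap_at_def free_def by auto

lemma gap_at_self: "x \<in> free \<sigma> \<Longrightarrow> x \<in> gap_at \<sigma> x"
  unfolding gap_at_def by auto

lemma gap_at_subset: "gap_at \<sigma> x \<subseteq> free \<sigma>"
  unfolding gap_at_def by force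

lemma gap_at_cong: assumes "y \<in> gap_at \<sigma> x" shows "gap_at \<sigma> y = gap_at \<sigma> x"
proof -
  have xy: "\<And>z. min x y \<le> z \<Longrightarrow> z \<le> max x y \<Longrightarrow> z \<in> free \<sigma>" using assms unfolding gap_at_def by auto
  show ?thesis
  proof (rule set_eqI)
    fix w
    show "w \<in> gap_at \<sigma> y \<longleftrightarrow> w \<in> gap_at \<sigma> x"
    proof
      assume "w \<in> gap_at \<sigma> y"
      then have "\<And>z. min y w \<le> z \<Longrightarrow> z \<le> max y w \<Longrightarrow> z \<in> free \<sigma>" unfolding gap_at_def by auto
      then have "z \<in> free \<sigma>" if "min x w \<le> z" "z \<le> max x w" for z
        using xy that by (cases "min x y \<le> z \<and> z \<le> max x y") auto
      then show "w \<in> gap_at \<sigma> x" unfolding gap_at_def by auto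
    next
      assume "w \<in> gap_at \<sigma> x"
      then have "\<And>z. min x w \<le> z \<Longrightarrow> z \<le> max x w \<Longrightarrow> z \<in> free \<sigma>" unfolding gap_at_def by auto
      then have "z \<in> free \<sigma>" if "min y w \<le> z" "z \<le> max y w" for z
        using xy that by (cases "min x y \<le> z \<and> z \<le> max x y") auto
      then show "w \<in> gap_at \<sigma> y" unfolding gap_at_def by auto
    qed
  qed
qed

text \<open>Sites to the right of \<open>A\<close> belong to it vacuously, so intersecting with the
  reflected set yields the whole gap.\<close>

definition leftpart :: "(int \<Rightarrow> bool) \<Rightarrow> int \<Rightarrow> int set" where
  "leftpart \<sigma> A = {y. \<forall>z. y \<le> z \<and> z \<le> A \<longrightarrow> z \<in> free \<sigma>}"

lemma gap_at_eq_parts: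
  assumes "A \<in> free \<sigma>"
  shows "gap_at \<sigma> A = {y. y \<in> leftpart \<sigma> A \<and> - y \<in> leftpart (mirror \<sigma>) (- A)}"
proof -
  have "y \<in> gap_at \<sigma> A \<longleftrightarrow> (\<forall>z. y \<le> z \<and> z \<le> A \<longrightarrow> z \<in> free \<sigma>) \<and> (\<forall>z. - y \<le> z \<and> z \<le> - A \<longrightarrow> - z \<in> free \<sigma>)" for y
  proof -
    have "(\<forall>z. - y \<le> z \<and> z \<le> - A \<longrightarrow> - z \<in> free \<sigma>) \<longleftrightarrow> (\<forall>z. A \<le> z \<and> z \<le> y \<longrightarrow> z \<in> free \<sigma>)"
      by (metis add.inverse_inverse neg_le_iff_le)
    then show ?thesis unfolding gap_at_def by (auto simp: subset_iff min_def max_def)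
  qed
  then show ?thesis unfolding leftpart_def free_mirror by blast
qed

lemma leftpart_None: "A \<in> free \<sigma> \<Longrightarrow> left_dist \<sigma> A = None \<Longrightarrow> leftpart \<sigma> A = UNIV"
proof -
  assume A: "A \<in> free \<sigma>" and "left_dist \<sigma> A = None"
  then have n: "\<not> \<sigma> z" if "z \<le> A" for z using that by (simp add: left_dist_eq_None_iff)
  have "z \<in> free \<sigma>" if "z \<le> A" for z
    using that A n[of z] n[of "z - 1"] n[of "z + 1"] by (cases "z = A") (auto simp: free_iff)
  then show ?thesis unfolding leftpart_def by auto
qed

text \<open>The neighbour of the nearest occupied site is a boundary site, so the gap starts two
  sites after that occupied site.\<close>

lemma leftpart_Some:
  assumes A: "A \<in> free \<sigma>" and e: "left_dist \<sigma> A = Some e"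
  shows "leftpart \<sigma> A = {A - int e + 2..}" "2 \<le> e"
proof -
  have occ: "\<sigma> (A - int e)" and n: "\<And>z. A - int e < z \<Longrightarrow> z \<le> A \<Longrightarrow> \<not> \<sigma> z"
    using left_dist_SomeD[OF e] by auto
  have "e \<noteq> 0" "e \<noteq> 1" using A occ by (auto simp: free_iff intro: ccontr)
  then show e2: "2 \<le> e" by linarith
  show "leftpart \<sigma> A = {A - int e + 2..}"
  proof (rule set_eqI)
    fix y
    show "y \<in> leftpart \<sigma> A \<longleftrightarrow> y \<in> {A - int e + 2..}"
    proof
      assume y: "y \<in> leftpart \<sigma> A"
      have "A - int e + 1 \<notin> free \<sigma>" using occ by (simp add: free_iff)
      then have "\<not> (y \<le> A - int e + 1)" using y e2 unfolding leftpart_def by force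
      then show "y \<in> {A - int e + 2..}" by simp
    next
      assume y: "y \<in> {A - int e + 2..}"
      have "z \<in> free \<sigma>" if "y \<le> z" "z \<le> A" for z
        using that y A n[of z] n[of "z - 1"] n[of "z + 1"] by (cases "z = A") (auto simp: free_iff)
      then show "y \<in> leftpart \<sigma> A" unfolding leftpart_def by auto
    qed
  qed
qed

lemma Omega'_iff: "\<sigma> \<in> Omega' \<longleftrightarrow> (\<forall>x. \<sigma> x \<longrightarrow> \<sigma> (x - 1) \<or> \<sigma> (x + 1))"
proof
  assume "\<sigma> \<in> Omega'"
  then show "\<forall>x. \<sigma> x \<longrightarrow> \<sigma> (x - 1) \<or> \<sigma> (x + 1)" unfolding Omega'_def T_def by auto
next
  assume "\<forall>x. \<sigma> x \<longrightarrow> \<sigma> (x - 1) \<or> \<sigma> (x + 1)"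
  then have "T \<sigma> = \<sigma>" unfolding T_def by auto
  then show "\<sigma> \<in> Omega'" unfolding Omega'_def by (metis rangeI)
qed

section \<open>Weights as scans\<close>

text \<open>\<open>gap_weight\<close> and \<open>window_weight\<close> are \<open>ZU\<close> and \<open>weight\<close> with the closed window \<open>clos \<Lambda>\<close>
  replaced by an arbitrary interval \<open>{A..B}\<close>, which can be shrunk down to one site.\<close>

definition gap_weight :: "real \<Rightarrow> int \<Rightarrow> int \<Rightarrow> int set \<Rightarrow> real" where
  "gap_weight p A B U =
     (if finite U then Qpow p (card U + 1) 0 0 / (1 - p)
      else if bdd_above U \<and> \<not> bdd_below U then lambda_PF p ^ card (U \<inter> {A..}) / (1 - p)
      else if bdd_below U \<and> \<not> bdd_above U then lambda_PF p ^ card (U \<inter> {..B}) / (1 - p)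
      else if U = UNIV then Dconst p * lambda_PF p ^ card ({A..} \<inter> {..B}) / (1 - p)
      else 0)"

definition window_weight :: "real \<Rightarrow> int \<Rightarrow> int \<Rightarrow> (int \<Rightarrow> bool) \<Rightarrow> real" where
  "window_weight p A B \<sigma> = p ^ card (Theta \<sigma> \<inter> {A..B}) * (1 - p) ^ card (bdry (Theta \<sigma>) \<inter> {A..B})
     * (\<Prod>U \<in> gap_at \<sigma> ` (free \<sigma> \<inter> {A - 1..B + 1}). gap_weight p A B U)"

lemma clos_interval: "l \<le> r \<Longrightarrow> clos {l..r} = {l - 1..r + (1::int)}"
proof -
  assume lr: "l \<le> r"
  have "x \<in> clos {l..r} \<longleftrightarrow> x \<in> {l - 1..r + 1}" for x
  proof
    assume "x \<in> {l - 1..r + 1}"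
    then consider "x \<in> {l..r}" | "x = l - 1" | "x = r + 1" by force
    then show "x \<in> clos {l..r}"
      by cases (use lr in \<open>auto simp: clos_def bdry_def intro: bexI[of _ l] bexI[of _ r]\<close>)
  qed (auto simp: clos_def bdry_def)
  then show ?thesis by blast
qed

lemma weight_eq_window_weight:
  assumes "l \<le> r"
  shows "weight p {l..r} \<sigma> = window_weight p (l - 1) (r + 1) \<sigma>"
proof -
  have c: "clos {l..r} = {l - 1..r + 1}" by (rule clos_interval[OF assms])
  have "Min {l - 1..r + 1} = l - 1" "Max {l - 1..r + 1} = r + 1"
    using assms by (auto intro!: Min_eqI Max_eqI)
  then have Z: "ZU p {l..r} = gap_weight p (l - 1) (r + 1)"
    unfolding ZU_def gap_weight_def Vminus_def Vplus_def c fun_eq_iff by simp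
  have "Ucomps_Lam {l..r} \<sigma> = gap_at \<sigma> ` (free \<sigma> \<inter> {l - 1 - 1..r + 1 + 1})"
  proof (rule set_eqI)
    fix U
    show "U \<in> Ucomps_Lam {l..r} \<sigma> \<longleftrightarrow> U \<in> gap_at \<sigma> ` (free \<sigma> \<inter> {l - 1 - 1..r + 1 + 1})"
    proof
      assume "U \<in> Ucomps_Lam {l..r} \<sigma>"
      then obtain x i j where U: "U = gap_at \<sigma> x" "i \<in> {l - 1..r + 1}" "j \<in> U" "\<bar>i - j\<bar> \<le> 1"
        unfolding Ucomps_Lam_def c Ucomps_eq by auto
      then have "U = gap_at \<sigma> j" "j \<in> free \<sigma>" using gap_at_cong gap_at_subset by blast+
      moreover have "j \<in> {l - 1 - 1..r + 1 + 1}" using U(2,4) by auto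
      ultimately show "U \<in> gap_at \<sigma> ` (free \<sigma> \<inter> {l - 1 - 1..r + 1 + 1})" by blast
    next
      assume "U \<in> gap_at \<sigma> ` (free \<sigma> \<inter> {l - 1 - 1..r + 1 + 1})"
      then obtain x where x: "U = gap_at \<sigma> x" "x \<in> free \<sigma>" "l - 2 \<le> x" "x \<le> r + 2" by auto
      have "max (l - 1) (min x (r + 1)) \<in> {l - 1..r + 1}" "\<bar>max (l - 1) (min x (r + 1)) - x\<bar> \<le> 1"
        using assms x by auto
      then show "U \<in> Ucomps_Lam {l..r} \<sigma>"
        unfolding Ucomps_Lam_def c Ucomps_eq using x gap_at_self by blast
    qed
  qed
  then show ?thesis unfolding weight_def window_weight_def Z c by simp
qed

lemma mem_Theta: "x \<in> Theta \<sigma> \<longleftrightarrow> \<sigma> x"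
  by (simp add: Theta_def)

lemma not_bdd_int:
  "\<not> bdd_above {x::int..}" "\<not> bdd_below {..x::int}" "\<not> bdd_above (UNIV::int set)" "\<not> bdd_below (UNIV::int set)"
proof -
  have "\<exists>y\<in>{x..}. M < y" for M by (rule bexI[of _ "max x (M + 1)"]) auto
  then show "\<not> bdd_above {x..}" unfolding bdd_above_def by (meson not_le)
  have "\<exists>y\<in>{..x}. y < M" for M by (rule bexI[of _ "min x (M - 1)"]) auto
  then show "\<not> bdd_below {..x}" unfolding bdd_below_def by (meson not_le)
  show "\<not> bdd_above (UNIV::int set)" "\<not> bdd_below (UNIV::int set)"
    unfolding bdd_above_def bdd_below_def by (metis UNIV_I gt_ex lt_ex not_le)+
qed

lemma gap_bdd_below:
  assumes "A \<in> free \<sigma>"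
  shows "bdd_below (gap_at \<sigma> A) \<longleftrightarrow> left_dist \<sigma> A \<noteq> None"
proof (cases "left_dist \<sigma> A")
  case None
  have "y \<in> gap_at \<sigma> A" if "y \<le> A" for y
  proof -
    have "y \<in> leftpart \<sigma> A" unfolding leftpart_None[OF assms None] by simp
    then show ?thesis using that unfolding leftpart_def gap_at_def by (auto simp: min_def max_def)
  qed
  then have "{..A} \<subseteq> gap_at \<sigma> A" by auto
  then show ?thesis using None not_bdd_int(2)[of A] bdd_below_mono[of "gap_at \<sigma> A" "{..A}"] by auto
next
  case (Some e)
  have "gap_at \<sigma> A \<subseteq> {A - int e + 2..}"
    unfolding gap_at_eq_parts[OF assms] leftpart_Some(1)[OF assms Some] by auto
  then show ?thesis using Some by (auto intro: bdd_below_mono[OF bdd_below_Ici])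
qed

text \<open>Only gaps unbounded to the left have a weight that counts sites from the left end of the
  window. Such a gap loses one power of \<open>lambda_PF p\<close> if it contains \<open>A\<close>;
  all other weights are unchanged.\<close>

lemma prod_gap_weight_step:
  assumes AB: "A < B"
  shows "(\<Prod>U \<in> gap_at \<sigma> ` (free \<sigma> \<inter> {A..B + 1}). gap_weight p A B U) =
    (if A \<in> free \<sigma> \<and> left_dist \<sigma> A = None then lambda_PF p else 1) *
    (\<Prod>U \<in> gap_at \<sigma> ` (free \<sigma> \<inter> {A..B + 1}). gap_weight p (A + 1) B U)"
proof -
  let ?I = "gap_at \<sigma> ` (free \<sigma> \<inter> {A..B + 1})"
  have fin: "finite ?I" by simp
  have same: "gap_weight p A B U = gap_weight p (A + 1) B U" if "A \<notin> U \<or> bdd_below U" "U \<noteq> {}" for U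
  proof -
    have "U \<noteq> UNIV" using that not_bdd_int by auto
    moreover have "U \<inter> {A..} = U \<inter> {A + 1..}" if "A \<notin> U"
    proof -
      have "A \<le> x \<and> x \<noteq> A \<longleftrightarrow> A + 1 \<le> x" for x by auto
      then show ?thesis using that by force
    qed
    ultimately show ?thesis using that unfolding gap_weight_def by auto
  qed
  show ?thesis
  proof (cases "A \<in> free \<sigma> \<and> left_dist \<sigma> A = None")
    case True
    let ?U = "gap_at \<sigma> A"
    have mem: "?U \<in> ?I" using True AB by auto
    have nb: "\<not> bdd_below ?U" using True gap_bdd_below by auto
    then have inf: "infinite ?U" by auto
    have AU: "A \<in> ?U" using True by (simp add: gap_at_self)
    have "gap_weight p A B ?U = lambda_PF p * gap_weight p (A + 1) B ?U"
    proof (cases "bdd_above ?U")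
      case bd: True
      then obtain M where M: "\<And>x. x \<in> ?U \<Longrightarrow> x \<le> M" unfolding bdd_above_def by auto
      have f: "finite (?U \<inter> {A + 1..})" by (rule finite_subset[of _ "{A + 1..M}"]) (use M in auto)
      have "?U \<inter> {A..} = insert A (?U \<inter> {A + 1..})" using AU by auto
      then have "card (?U \<inter> {A..}) = Suc (card (?U \<inter> {A + 1..}))" using f by simp
      then show ?thesis unfolding gap_weight_def using inf nb bd by simp
    next
      case False
      have "{A..} \<inter> {..B} = {A..B}" "{A + 1..} \<inter> {..B} = {A + 1..B}" for B by auto
      moreover have "card {A..B} = Suc (card {A + 1..B})" using AB by simp
      ultimately show ?thesis unfolding gap_weight_def using inf nb False by simp
    qed
    moreover have "gap_weight p A B U = gap_weight p (A + 1) B U" if "U \<in> ?I - {?U}" for U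
    proof (rule same)
      show "U \<noteq> {}" using that gap_at_self by auto
      show "A \<notin> U \<or> bdd_below U" using that gap_at_cong by auto
    qed
    ultimately show ?thesis using True unfolding prod.remove[OF fin mem] by (auto intro: prod.cong)
  next
    case False
    have "gap_weight p A B U = gap_weight p (A + 1) B U" if "U \<in> ?I" for U
    proof (rule same)
      show "U \<noteq> {}" using that gap_at_self by auto
      show "A \<notin> U \<or> bdd_below U" using that False gap_at_cong gap_at_subset gap_bdd_below by (metis imageE subsetD)
    qed
    then have "(\<Prod>U \<in> ?I. gap_weight p A B U) = (\<Prod>U \<in> ?I. gap_weight p (A + 1) B U)" by (rule prod.cong[OF refl])
    then show ?thesis using False by auto
  qed
qed

text \<open>The factor lost when \<open>A\<close> leaves the window. A finite gap is charged as a
  whole at the boundary site after it, so its own sites carry 1; a gap unbounded to the left pays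
  \<open>lambda_PF p\<close> for each site instead.\<close>

definition site_factor :: "real \<Rightarrow> int \<Rightarrow> int \<Rightarrow> (int \<Rightarrow> bool) \<Rightarrow> real" where
  "site_factor p A B \<sigma> = (if \<sigma> A then p
     else if A \<in> free \<sigma> then (if left_dist \<sigma> A = None then lambda_PF p else 1)
     else (1 - p) * (if A - 1 \<in> free \<sigma> then gap_weight p A B (gap_at \<sigma> (A - 1)) else 1))"

lemma gap_at_adjacent: "A \<in> free \<sigma> \<Longrightarrow> A - 1 \<in> free \<sigma> \<Longrightarrow> gap_at \<sigma> (A - 1) = gap_at \<sigma> A"
proof (rule gap_at_cong)
  assume "A \<in> free \<sigma>" "A - 1 \<in> free \<sigma>"
  moreover have "{min A (A - 1)..max A (A - 1)} = {A - 1, A}" by (auto simp: min_def max_def)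
  ultimately show "A - 1 \<in> gap_at \<sigma> A" unfolding gap_at_def by auto
qed

lemma gap_at_separated:
  assumes "A \<notin> free \<sigma>" "x < A" "A < y" "x \<in> free \<sigma>" "y \<in> free \<sigma>"
  shows "gap_at \<sigma> x \<noteq> gap_at \<sigma> y"
proof
  assume "gap_at \<sigma> x = gap_at \<sigma> y"
  then have "x \<in> gap_at \<sigma> y" using gap_at_self assms by auto
  then have "{min y x..max y x} \<subseteq> free \<sigma>" unfolding gap_at_def by simp
  moreover have "A \<in> {min y x..max y x}" using assms by simp
  ultimately have "A \<in> free \<sigma>" by blast
  then show False using assms by simp
qed

lemma card_interval_step:
  assumes "A \<le> (B::int)"
  shows "card (S \<inter> {A..B}) = (if A \<in> S then 1 else 0) + card (S \<inter> {A + 1..B})"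
proof -
  have "{A..B} = insert A {A + 1..B}" using assms by auto
  moreover have "A \<notin> {A + 1..B}" by simp
  ultimately show ?thesis by (simp add: Int_insert_right)
qed

text \<open>The product can lose only the gap of \<open>A - 1\<close>, and only if that gap ends
  there: if \<open>A\<close> is free as well, the same gap still counts through
  \<open>A\<close>.\<close>

lemma window_weight_step:
  assumes AB: "A < B"
  shows "window_weight p A B \<sigma> = site_factor p A B \<sigma> * window_weight p (A + 1) B \<sigma>"
proof -
  define P where "P = (\<Prod>U \<in> gap_at \<sigma> ` (free \<sigma> \<inter> {A..B + 1}). gap_weight p (A + 1) B U)"
  define f where "f = (if A \<in> free \<sigma> \<and> left_dist \<sigma> A = None then lambda_PF p else 1)"
  let ?g = "if A \<notin> free \<sigma> \<and> A - 1 \<in> free \<sigma> then gap_weight p A B (gap_at \<sigma> (A - 1)) else 1"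
  have ins: "{A - 1..B + 1} = insert (A - 1) {A..B + 1}" using AB by auto
  have "(\<Prod>U \<in> gap_at \<sigma> ` (free \<sigma> \<inter> {A - 1..B + 1}). gap_weight p A B U) = ?g * (f * P)"
  proof -
    have *: "(\<Prod>U \<in> gap_at \<sigma> ` (free \<sigma> \<inter> {A..B + 1}). gap_weight p A B U) = f * P"
      unfolding P_def f_def by (rule prod_gap_weight_step[OF AB])
    show ?thesis
    proof (cases "A - 1 \<in> free \<sigma>")
      case False
      then show ?thesis unfolding ins using * by (simp add: Int_insert_right)
    next
      case A1: True
      then have i: "gap_at \<sigma> ` (free \<sigma> \<inter> {A - 1..B + 1}) = insert (gap_at \<sigma> (A - 1)) (gap_at \<sigma> ` (free \<sigma> \<inter> {A..B + 1}))"
        unfolding ins by simp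
      show ?thesis
      proof (cases "A \<in> free \<sigma>")
        case True
        then have "gap_at \<sigma> (A - 1) \<in> gap_at \<sigma> ` (free \<sigma> \<inter> {A..B + 1})"
          using gap_at_adjacent[OF True A1] AB by auto
        then show ?thesis unfolding i insert_absorb[OF \<open>gap_at \<sigma> (A - 1) \<in> _\<close>] using * True by simp
      next
        case False
        have "gap_at \<sigma> (A - 1) \<notin> gap_at \<sigma> ` (free \<sigma> \<inter> {A..B + 1})"
        proof
          assume "gap_at \<sigma> (A - 1) \<in> gap_at \<sigma> ` (free \<sigma> \<inter> {A..B + 1})"
          then obtain y where y: "y \<in> free \<sigma>" "A \<le> y" "gap_at \<sigma> (A - 1) = gap_at \<sigma> y" by auto
          then have "A < y" using False by (cases "A = y") auto
          then show False using gap_at_separated[OF False _ _ A1 y(1)] y(3) by auto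
        qed
        then show ?thesis unfolding i using * A1 False by simp
      qed
    qed
  qed
  moreover have "free \<sigma> \<inter> {A + 1 - 1..B + 1} = free \<sigma> \<inter> {A..B + 1}" by simp
  moreover have "card (Theta \<sigma> \<inter> {A..B}) = (if \<sigma> A then 1 else 0) + card (Theta \<sigma> \<inter> {A + 1..B})"
    using card_interval_step[of A B "Theta \<sigma>"] AB by (simp add: mem_Theta)
  moreover have "card (bdry (Theta \<sigma>) \<inter> {A..B}) =
      (if \<not> \<sigma> A \<and> A \<notin> free \<sigma> then 1 else 0) + card (bdry (Theta \<sigma>) \<inter> {A + 1..B})"
    using card_interval_step[of A B "bdry (Theta \<sigma>)"] AB by (simp add: bdry_Theta_iff free_iff)
  ultimately have "window_weight p A B \<sigma> = p ^ (if \<sigma> A then 1 else 0) * (1 - p) ^ (if \<not> \<sigma> A \<and> A \<notin> free \<sigma> then 1 else 0)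
      * ?g * f * window_weight p (A + 1) B \<sigma>"
    unfolding window_weight_def P_def by (simp only: power_add mult_ac)
  moreover have "\<sigma> A \<Longrightarrow> A \<notin> free \<sigma> \<and> A - 1 \<notin> free \<sigma>" by (simp add: free_iff)
  ultimately show ?thesis unfolding site_factor_def f_def by auto
qed

lemma window_weight_single:
  "window_weight p A A \<sigma> = (if \<sigma> A then p
     else if A \<in> free \<sigma> then gap_weight p A A (gap_at \<sigma> A)
     else (1 - p) * (if A - 1 \<in> free \<sigma> then gap_weight p A A (gap_at \<sigma> (A - 1)) else 1)
       * (if A + 1 \<in> free \<sigma> then gap_weight p A A (gap_at \<sigma> (A + 1)) else 1))"
proof -
  have i: "{A - 1..A + 1} = {A - 1, A, A + 1}" by auto
  have c: "S \<inter> {A..A} = (if A \<in> S then {A} else {})" for S by auto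
  consider (occ) "\<sigma> A" | (fr) "A \<in> free \<sigma>" "\<not> \<sigma> A" | (bd) "A \<notin> free \<sigma>" "\<not> \<sigma> A"
    by (auto simp: free_iff)
  then show ?thesis
  proof cases
    case occ
    then have "free \<sigma> \<inter> {A - 1..A + 1} = {}" unfolding i by (auto simp: free_iff)
    then show ?thesis using occ unfolding window_weight_def c by (simp add: mem_Theta bdry_Theta_iff)
  next
    case fr
    have "gap_at \<sigma> ` (free \<sigma> \<inter> {A - 1..A + 1}) = {gap_at \<sigma> A}"
      unfolding i using fr gap_at_adjacent[of A \<sigma>] gap_at_adjacent[of "A + 1" \<sigma>] by auto
    then show ?thesis using fr unfolding window_weight_def c by (simp add: mem_Theta bdry_Theta_iff free_iff)
  next
    case bd
    have "A - 1 \<in> free \<sigma> \<Longrightarrow> A + 1 \<in> free \<sigma> \<Longrightarrow> gap_at \<sigma> (A - 1) \<noteq> gap_at \<sigma> (A + 1)"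
      using gap_at_separated[OF bd(1), of "A - 1" "A + 1"] by simp
    then show ?thesis using bd unfolding window_weight_def c i
      by (auto simp add: mem_Theta bdry_Theta_iff free_iff[of A] Int_insert_right)
  qed
qed

section \<open>Gap weights in terms of distances to occupied sites\<close>

context tbf begin

definition gap_param :: "nat option \<Rightarrow> real" where
  "gap_param d = (case d of None \<Rightarrow> 0 | Some e \<Rightarrow> a ^ e)"

definition gap_const :: "nat option \<Rightarrow> real" where
  "gap_const d = (case d of None \<Rightarrow> 1 | Some e \<Rightarrow> lam ^ e / (lam * (1 - a)))"

lemma gap_param_simps [simp]: "gap_param None = 0" "gap_param (Some e) = a ^ e" "gap_param (map_option Suc d) = a * gap_param d"
  unfolding gap_param_def by (cases d; simp)+

text \<open>At distances \<open>e\<close> and \<open>f\<close> the site \<open>A\<close> is counted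
  on both sides: the gap has e + f - 3 sites and the exponent of \<open>a\<close> is e + f - 1,
  hence the division by \<open>a\<close>. \<open>Dconst_eq\<close> makes the case without occupied
  sites fit.\<close>

lemma gap_weight_through:
  assumes A: "A \<in> free \<sigma>"
  shows "gap_weight p A A (gap_at \<sigma> A) =
    gap_const (left_dist \<sigma> A) * gap_const (left_dist (mirror \<sigma>) (- A)) * (1 - a)
      * (1 - gap_param (left_dist \<sigma> A) * gap_param (left_dist (mirror \<sigma>) (- A)) / a) / (1 - p)"
proof -
  have A': "- A \<in> free (mirror \<sigma>)" using A by (simp add: free_mirror)
  have nz: "lam \<noteq> 0" "1 - a \<noteq> 0" "a \<noteq> 0" "1 - p \<noteq> 0" using lam_pos a_neg p_less_1 by auto
  show ?thesis
  proof (cases "left_dist \<sigma> A"; cases "left_dist (mirror \<sigma>) (- A)")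
    assume d: "left_dist \<sigma> A = None" "left_dist (mirror \<sigma>) (- A) = None"
    have "gap_at \<sigma> A = UNIV"
      unfolding gap_at_eq_parts[OF A] leftpart_None[OF A d(1)] leftpart_None[OF A' d(2)] by simp
    moreover have "{A..} \<inter> {..A} = {A}" by auto
    ultimately have "gap_weight p A A (gap_at \<sigma> A) = Dconst p * lam / (1 - p)"
      unfolding gap_weight_def lam_def by (simp add: not_bdd_int infinite_UNIV_int)
    then show ?thesis unfolding d Dconst_eq gap_const_def using nz by simp
  next
    fix e assume d: "left_dist \<sigma> A = None" "left_dist (mirror \<sigma>) (- A) = Some e"
    have g: "gap_at \<sigma> A = {..A + int e - 2}"
      unfolding gap_at_eq_parts[OF A] leftpart_None[OF A d(1)] leftpart_Some(1)[OF A' d(2)] by auto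
    obtain k where k: "e = Suc (Suc k)" using leftpart_Some(2)[OF A' d(2)] by (metis add_2_eq_Suc le_Suc_ex)
    have "{..A + int e - 2} \<inter> {A..} = {A..A + int k}" unfolding k by auto
    then have "card ({..A + int e - 2} \<inter> {A..}) = Suc k" by simp
    then have "gap_weight p A A (gap_at \<sigma> A) = lam ^ Suc k / (1 - p)"
      unfolding g gap_weight_def lam_def by (simp add: not_bdd_int infinite_Iic del: power_Suc)
    then show ?thesis unfolding d gap_const_def k using nz by simp
  next
    fix e assume d: "left_dist \<sigma> A = Some e" "left_dist (mirror \<sigma>) (- A) = None"
    have g: "gap_at \<sigma> A = {A - int e + 2..}"
      unfolding gap_at_eq_parts[OF A] leftpart_Some(1)[OF A d(1)] leftpart_None[OF A' d(2)] by auto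
    obtain k where k: "e = Suc (Suc k)" using leftpart_Some(2)[OF A d(1)] by (metis add_2_eq_Suc le_Suc_ex)
    have "{A - int e + 2..} \<inter> {..A} = {A - int k..A}" unfolding k by auto
    then have "card ({A - int e + 2..} \<inter> {..A}) = Suc k" by simp
    then have "gap_weight p A A (gap_at \<sigma> A) = lam ^ Suc k / (1 - p)"
      unfolding g gap_weight_def lam_def by (simp add: not_bdd_int infinite_Ici del: power_Suc)
    then show ?thesis unfolding d gap_const_def k using nz by simp
  next
    fix e f assume d: "left_dist \<sigma> A = Some e" "left_dist (mirror \<sigma>) (- A) = Some f"
    obtain k where k: "e = Suc (Suc k)" using leftpart_Some(2)[OF A d(1)] by (metis add_2_eq_Suc le_Suc_ex)
    obtain m where m: "f = Suc (Suc m)" using leftpart_Some(2)[OF A' d(2)] by (metis add_2_eq_Suc le_Suc_ex)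
    have "gap_at \<sigma> A = {A - int k..A + int m}"
      unfolding gap_at_eq_parts[OF A] leftpart_Some(1)[OF A d(1)] leftpart_Some(1)[OF A' d(2)] k m by auto
    moreover have "card {A - int k..A + int m} = Suc (k + m)" by simp
    ultimately have "gap_weight p A A (gap_at \<sigma> A) = Qpow p (Suc (Suc (k + m))) 0 0 / (1 - p)"
      unfolding gap_weight_def by (simp del: Qpow.simps card_atLeastAtMost_int)
    then show ?thesis unfolding Qpow_eq' d gap_const_def k m using nz by (simp add: power_add)
  qed
qed

text \<open>The gap ends just outside the window. If it is infinite, it has no site in
  \<open>{A..}\<close>, and its weight 1 / (1 - p) is the value at parameter 0.\<close>

lemma gap_weight_left:
  assumes A: "\<not> \<sigma> A" "A \<notin> free \<sigma>" "A - 1 \<in> free \<sigma>"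
  shows "gap_weight p A B (gap_at \<sigma> (A - 1)) = gap_const (left_dist \<sigma> A) * (1 - gap_param (left_dist \<sigma> A)) / (1 - p)"
proof -
  have nz: "lam \<noteq> 0" "1 - a \<noteq> 0" "1 - p \<noteq> 0" using lam_pos a_neg p_less_1 by auto
  have r: "- y \<in> leftpart (mirror \<sigma>) (- (A - 1)) \<longleftrightarrow> y \<le> A - 1" for y
  proof -
    have A': "- A \<notin> free (mirror \<sigma>)" "1 - A \<in> free (mirror \<sigma>)" using A by (auto simp: free_mirror)
    show ?thesis
    proof
      assume "- y \<in> leftpart (mirror \<sigma>) (- (A - 1))"
      then show "y \<le> A - 1" using A'(1) unfolding leftpart_def by (force simp: not_le[symmetric])
    next
      assume y: "y \<le> A - 1"
      have "z = 1 - A" if "- y \<le> z" "z \<le> - (A - 1)" for z using that y by simp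
      then show "- y \<in> leftpart (mirror \<sigma>) (- (A - 1))" using A'(2) unfolding leftpart_def by blast
    qed
  qed
  have st: "left_dist \<sigma> A = map_option Suc (left_dist \<sigma> (A - 1))" by (rule left_dist_step[of \<sigma> A]) (use A in auto)
  show ?thesis
  proof (cases "left_dist \<sigma> (A - 1)")
    case None
    have g: "gap_at \<sigma> (A - 1) = {..A - 1}"
      unfolding gap_at_eq_parts[OF A(3)] leftpart_None[OF A(3) None] r by auto
    have "{..A - 1} \<inter> {A..} = {}" by auto
    then show ?thesis unfolding g gap_weight_def st None gap_const_def by (simp add: not_bdd_int infinite_Iic)
  next
    case (Some e)
    have g: "gap_at \<sigma> (A - 1) = {A - 1 - int e + 2..A - 1}"
      unfolding gap_at_eq_parts[OF A(3)] leftpart_Some(1)[OF A(3) Some] r by auto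
    obtain k where k: "e = Suc (Suc k)" using leftpart_Some(2)[OF A(3) Some] by (metis add_2_eq_Suc le_Suc_ex)
    have "card {A - 1 - int e + 2..A - 1} = Suc k" unfolding k by simp
    then have "gap_weight p A B (gap_at \<sigma> (A - 1)) = Qpow p (Suc (Suc k)) 0 0 / (1 - p)"
      unfolding g gap_weight_def by (simp del: Qpow.simps card_atLeastAtMost_int)
    then show ?thesis unfolding Qpow_eq' st Some gap_const_def k using nz by simp
  qed
qed

end

section \<open>Reflection, and the scan of a configuration\<close>

lemma gap_at_mirror: "gap_at (mirror \<sigma>) (- x) = uminus ` gap_at \<sigma> x"
proof -
  have im: "uminus ` S = {y. - y \<in> S}" for S :: "int set"
  proof (rule set_eqI)
    fix y
    have "- y \<in> S \<Longrightarrow> - (- y) \<in> uminus ` S" by (rule imageI)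
    then show "y \<in> uminus ` S \<longleftrightarrow> y \<in> {y. - y \<in> S}" by auto
  qed
  have "{min (- x) y..max (- x) y} = uminus ` {min x (- y)..max x (- y)}" for y
    by (auto simp: min_def max_def)
  moreover have "free (mirror \<sigma>) = uminus ` free \<sigma>"
    unfolding im by (rule set_eqI) (simp add: free_mirror)
  ultimately have "{min (- x) y..max (- x) y} \<subseteq> free (mirror \<sigma>) \<longleftrightarrow> {min x (- y)..max x (- y)} \<subseteq> free \<sigma>" for y
    by (simp add: inj_image_subset_iff[of uminus] del: image_uminus_atLeastAtMost)
  then show ?thesis unfolding gap_at_def im by simp
qed

lemma gap_weight_mirror: "gap_weight p (- B) (- A) (uminus ` U) = gap_weight p A B U"
proof -
  have i: "inj_on uminus S" for S :: "int set" by auto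
  have "uminus ` U \<inter> {- B..} = uminus ` (U \<inter> {..B})" "uminus ` U \<inter> {..- A} = uminus ` (U \<inter> {A..})" by auto
  then have c: "card (uminus ` U \<inter> {- B..}) = card (U \<inter> {..B})" "card (uminus ` U \<inter> {..- A}) = card (U \<inter> {A..})"
    "card (uminus ` U) = card U"
    by (simp_all only: card_image[OF i])
  have "{- B..} \<inter> {..- A} = {- B..- A}" "{A..} \<inter> {..B} = {A..B}" by auto
  then have c': "card ({- B..} \<inter> {..- A}) = card ({A..} \<inter> {..B})" by simp
  have "uminus ` U = UNIV \<longleftrightarrow> U = UNIV"
    by (metis (no_types, opaque_lifting) UNIV_I UNIV_eq_I image_iff minus_minus surj_uminus)
  then show ?thesis unfolding gap_weight_def c c' by (auto simp: finite_image_iff[OF i])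
qed

context tbf begin

text \<open>After an occupied \<open>A - 1\<close> the extra \<open>1 - p\<close> belongs to the
  boundary site \<open>A\<close>. Otherwise the boundary site at the left end of the run, if any,
  lies outside the window and is not counted.\<close>

definition side_const :: "(int \<Rightarrow> bool) \<Rightarrow> int \<Rightarrow> real" where
  "side_const \<sigma> A = (if \<sigma> A then p else if \<sigma> (A - 1) then (1 - p) / (1 - a) else gap_const (left_dist \<sigma> A))"

definition side_of :: "(int \<Rightarrow> bool) \<Rightarrow> int \<Rightarrow> side" where
  "side_of \<sigma> A = (if \<sigma> A then (if \<sigma> (A - 1) then Paired else Single) else Gap (gap_param (left_dist \<sigma> A)))"

text \<open>If \<open>A - 1\<close> or \<open>A - 2\<close> is occupied there is no gap, yet the gap
  formula at distance 1 or 2 still gives \<open>1 - p\<close>, the latter as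
  \<open>lam * (1 + a)\<close>.\<close>

lemma edge_left:
  assumes "\<not> \<sigma> A" "A \<notin> free \<sigma>"
  shows "(1 - p) * (if A - 1 \<in> free \<sigma> then gap_weight p A B (gap_at \<sigma> (A - 1)) else 1)
    = side_const \<sigma> A * (1 - gap_param (left_dist \<sigma> A))"
proof -
  have nz: "lam \<noteq> 0" "1 - a \<noteq> 0" "1 - p \<noteq> 0" using lam_pos a_neg p_less_1 by auto
  have d: "left_dist \<sigma> A = map_option Suc (left_dist \<sigma> (A - 1))" by (rule left_dist_step[of \<sigma> A]) fact
  consider (one) "\<sigma> (A - 1)" | (two) "\<not> \<sigma> (A - 1)" "\<sigma> (A - 2)" | (free) "A - 1 \<in> free \<sigma>"
    using assms by (auto simp: free_iff)
  then show ?thesis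
  proof cases
    case one
    then show ?thesis using assms nz unfolding d side_const_def by (simp add: left_dist_occ free_iff)
  next
    case two
    then have d2: "left_dist \<sigma> A = Some 2" unfolding d using left_dist_step[of \<sigma> "A - 1"] by (simp add: left_dist_occ numeral_2_eq_2)
    have "gap_const (Some 2) * (1 - a\<^sup>2) = lam * (1 + a)"
      unfolding gap_const_def using nz by (simp add: field_simps power2_eq_square)
    then show ?thesis using two assms unfolding side_const_def d2 lam_a by (simp add: free_iff)
  next
    case free
    then have "\<not> \<sigma> (A - 1)" by (simp add: free_iff)
    then show ?thesis using free gap_weight_left[OF assms free] assms nz unfolding side_const_def by simp
  qed
qed

lemma edge_right:
  assumes "\<not> \<sigma> A" "A \<notin> free \<sigma>"
  shows "(1 - p) * (if A + 1 \<in> free \<sigma> then gap_weight p A A (gap_at \<sigma> (A + 1)) else 1)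
    = side_const (mirror \<sigma>) (- A) * (1 - gap_param (left_dist (mirror \<sigma>) (- A)))"
proof -
  have "\<not> mirror \<sigma> (- A)" "- A \<notin> free (mirror \<sigma>)" using assms by (auto simp: mirror_def free_mirror)
  note e = edge_left[OF this, of "- A"]
  have f: "- A - 1 \<in> free (mirror \<sigma>) \<longleftrightarrow> A + 1 \<in> free \<sigma>" by (simp add: free_mirror add.commute)
  have Z: "gap_weight p (- A) (- A) (gap_at (mirror \<sigma>) (- A - 1)) = gap_weight p A A (gap_at \<sigma> (A + 1))"
    using gap_at_mirror[of \<sigma> "A + 1"] gap_weight_mirror[of p A A] by simp
  show ?thesis using e unfolding f Z .
qed

lemma site_factor_eq:
  "site_factor p A B \<sigma> = (if \<sigma> A then p
     else if A \<in> free \<sigma> then (if left_dist \<sigma> A = None then lam else 1)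
     else side_const \<sigma> A * (1 - gap_param (left_dist \<sigma> A)))"
  unfolding site_factor_def lam_def[symmetric] using edge_left[of \<sigma> A B] by simp

text \<open>The uniform factor \<open>lam\<close> of the scan has three sources: \<open>A\<close> is
  a boundary site, or is free with the gap bounded on the left, or is free with it unbounded
  there.\<close>

lemma site_factor_gap:
  assumes "\<not> \<sigma> A" "\<not> \<sigma> (A + 1)"
  shows "site_factor p A B \<sigma> * side_const \<sigma> (A + 1) = lam * side_const \<sigma> A"
proof -
  have nz: "lam \<noteq> 0" "1 - a \<noteq> 0" using lam_pos a_neg by auto
  have d: "left_dist \<sigma> (A + 1) = map_option Suc (left_dist \<sigma> A)" using left_dist_step[of \<sigma> "A + 1"] assms by simp
  have c: "side_const \<sigma> (A + 1) = gap_const (left_dist \<sigma> (A + 1))" unfolding side_const_def using assms by simp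
  show ?thesis
  proof (cases "\<sigma> (A - 1)")
    case True
    then have "left_dist \<sigma> A = Some 1" using left_dist_step[of \<sigma> A] assms by (simp add: left_dist_occ)
    then show ?thesis unfolding site_factor_eq c d using assms True nz
      by (simp add: side_const_def free_iff gap_const_def)
  next
    case False
    then have "A \<in> free \<sigma>" using assms by (simp add: free_iff)
    then show ?thesis unfolding site_factor_eq c d using assms False nz
      by (cases "left_dist \<sigma> A") (simp_all add: side_const_def gap_const_def)
  qed
qed

lemma side_of_gap_step: "\<not> \<sigma> (A + 1) \<Longrightarrow> side_of \<sigma> (A + 1) = Gap (a * gap_param (left_dist \<sigma> A))"
  using left_dist_step[of \<sigma> "A + 1"] by (simp add: side_of_def)

lemma side_const_scan_step:
  assumes "\<sigma> \<in> Omega'"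
  shows "side_const \<sigma> A * scan E (side_of \<sigma> A) (\<sigma> (A + 1) # xs)
    = site_factor p A B \<sigma> * (side_const \<sigma> (A + 1) * scan E (side_of \<sigma> (A + 1)) xs)"
proof (cases "\<sigma> A")
  case True
  show ?thesis
  proof (cases "\<sigma> (A + 1)")
    case A1: True
    then show ?thesis using True by (simp add: side_of_def side_const_def site_factor_eq)
  next
    case False
    \<comment> \<open>An occupied site followed by an empty one is supported from the left, so the
      state is \<open>Paired\<close>.\<close>
    then have "\<sigma> (A - 1)" using assms True unfolding Omega'_iff by blast
    then show ?thesis using True False side_of_gap_step[of \<sigma> A, OF False]
      by (simp add: side_of_def[of _ A] side_const_def site_factor_eq left_dist_occ)
  qed
next
  case False
  show ?thesis
  proof (cases "\<sigma> (A + 1)")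
    case A1: True
    then have "A \<notin> free \<sigma>" by (simp add: free_iff)
    then show ?thesis using False A1 by (simp add: side_of_def side_const_def[of _ "A + 1"] site_factor_eq)
  next
    case A1: False
    have "site_factor p A B \<sigma> * (side_const \<sigma> (A + 1) * scan E (side_of \<sigma> (A + 1)) xs)
        = lam * side_const \<sigma> A * scan E (side_of \<sigma> (A + 1)) xs"
      using site_factor_gap[OF False A1, of B] by (metis mult.assoc)
    then show ?thesis using False A1 side_of_gap_step[of \<sigma> A, OF A1] by (auto simp add: side_of_def[of _ A] mult.commute)
  qed
qed

lemma window_weight_pair:
  assumes om: "\<sigma> \<in> Omega'"
  shows "window_weight p A (A + 1) \<sigma> = side_const \<sigma> A * side_const (mirror \<sigma>) (- (A + 1))
    * ends (side_of (mirror \<sigma>) (- (A + 1))) (side_of \<sigma> A)"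
proof -
  define B where "B = A + 1"
  have BA: "B - 1 = A" unfolding B_def by simp
  have nz: "lam \<noteq> 0" "1 - a \<noteq> 0" "1 - p \<noteq> 0" "a \<noteq> 0" using lam_pos a_neg p_less_1 by auto
  have st: "window_weight p A B \<sigma> = site_factor p A B \<sigma> * window_weight p B B \<sigma>" unfolding B_def by (rule window_weight_step) simp
  define c where "c = side_const (mirror \<sigma>) (- B)"
  define y where "y = gap_param (left_dist (mirror \<sigma>) (- B))"
  have m: "mirror \<sigma> (- B) = \<sigma> B" "mirror \<sigma> (- B - 1) = \<sigma> (B + 1)" by (simp_all add: mirror_def add.commute)
  have bd: "window_weight p B B \<sigma> = side_const \<sigma> B * (1 - gap_param (left_dist \<sigma> B)) * (c * (1 - y)) / (1 - p)"
    if "\<not> \<sigma> B" "B \<notin> free \<sigma>"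
  proof -
    \<comment> \<open>Both edge identities contain the factor \<open>1 - p\<close> of the site
      \<open>B\<close>, which the weight contains once.\<close>
    have "u * v * w = (u * v) * (u * w) / u" if "u \<noteq> 0" for u v w :: real using that by simp
    from this[OF nz(3)] show ?thesis
      unfolding window_weight_single c_def y_def edge_left[OF that, of B, symmetric] edge_right[OF that, symmetric]
      using that by simp
  qed
  have "window_weight p A B \<sigma> = side_const \<sigma> A * c * ends (side_of (mirror \<sigma>) (- B)) (side_of \<sigma> A)"
  proof (cases "\<sigma> A"; cases "\<sigma> B")
    assume "\<sigma> A" "\<sigma> B"
    then show ?thesis unfolding st window_weight_single site_factor_eq c_def using m by (simp add: side_const_def side_of_def)
  next
    assume s: "\<sigma> A" "\<not> \<sigma> B"
    then have 1: "\<sigma> (A - 1)" using om unfolding Omega'_iff B_def by blast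
    have 2: "B \<notin> free \<sigma>" using s BA by (simp add: free_iff)
    have d: "left_dist \<sigma> B = Some 1" using left_dist_step[of \<sigma> B] s BA by (simp add: left_dist_occ)
    have "window_weight p B B \<sigma> = c * (1 - y)" unfolding bd[OF s(2) 2] d using s BA nz by (simp add: side_const_def)
    then show ?thesis unfolding st site_factor_eq using s 1 m by (simp add: side_const_def side_of_def y_def)
  next
    assume s: "\<not> \<sigma> A" "\<sigma> B"
    then have 1: "\<sigma> (B + 1)" using om BA unfolding Omega'_iff by metis
    have 2: "A \<notin> free \<sigma>" using s B_def by (simp add: free_iff)
    show ?thesis unfolding st site_factor_eq window_weight_single c_def using s 1 2 m by (simp add: side_const_def[of "mirror \<sigma>"] side_of_def)
  next
    assume s: "\<not> \<sigma> A" "\<not> \<sigma> B"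
    have x: "gap_param (left_dist \<sigma> B) = a * gap_param (left_dist \<sigma> A)" using left_dist_step[of \<sigma> B] s BA by simp
    have r: "site_factor p A B \<sigma> * side_const \<sigma> B = lam * side_const \<sigma> A" unfolding B_def by (rule site_factor_gap) (use s B_def in auto)
    have e: "ends (side_of (mirror \<sigma>) (- B)) (side_of \<sigma> A) = lam * (1 - a) * (1 - gap_param (left_dist \<sigma> A) * y) / (1 - p)"
      using s m by (simp add: side_of_def y_def)
    have "site_factor p A B \<sigma> * window_weight p B B \<sigma> = (site_factor p A B \<sigma> * side_const \<sigma> B) * c * (1 - a) * (1 - gap_param (left_dist \<sigma> A) * y) / (1 - p)"
    proof (cases "\<sigma> (B + 1)")
      case True
      then have "B \<notin> free \<sigma>" by (simp add: free_iff)
      moreover have "left_dist (mirror \<sigma>) (- B) = Some 1" using left_dist_step[of "mirror \<sigma>" "- B"] s True m by (simp add: left_dist_occ)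
      then have "y = a" unfolding y_def by simp
      ultimately show ?thesis using bd s x by simp
    next
      case False
      then have f: "B \<in> free \<sigma>" using s BA by (simp add: free_iff)
      have "gap_const (left_dist \<sigma> B) = side_const \<sigma> B" "gap_const (left_dist (mirror \<sigma>) (- B)) = c"
        unfolding c_def side_const_def using s False m BA by auto
      then have "window_weight p B B \<sigma> = side_const \<sigma> B * c * (1 - a) * (1 - a * gap_param (left_dist \<sigma> A) * y / a) / (1 - p)"
        unfolding window_weight_single using s f gap_weight_through[OF f] x y_def by simp
      then show ?thesis using nz by simp
    qed
    then show ?thesis unfolding st r e by simp
  qed
  then show ?thesis unfolding B_def c_def .
qed

lemma window_weight_eq_scan:
  assumes om: "\<sigma> \<in> Omega'" and "A < B"
  shows "window_weight p A B \<sigma> = side_const \<sigma> A * side_const (mirror \<sigma>) (- B)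
    * scan (ends (side_of (mirror \<sigma>) (- B))) (side_of \<sigma> A) (map \<sigma> [A + 1..B - 1])"
  using assms(2)
proof (induction "nat (B - A - 1)" arbitrary: A)
  case 0
  then have "B = A + 1" by simp
  then show ?case using window_weight_pair[OF om, of A] by simp
next
  case (Suc k)
  then have AB: "A + 1 < B" by simp
  have IH: "window_weight p (A + 1) B \<sigma> = side_const \<sigma> (A + 1) * side_const (mirror \<sigma>) (- B)
    * scan (ends (side_of (mirror \<sigma>) (- B))) (side_of \<sigma> (A + 1)) (map \<sigma> [A + 1 + 1..B - 1])"
    by (rule Suc.hyps(1)) (use Suc in auto)
  have "map \<sigma> [A + 1..B - 1] = \<sigma> (A + 1) # map \<sigma> [A + 1 + 1..B - 1]"
    using AB upto_rec1[of "A + 1" "B - 1"] by simp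
  then show ?case unfolding window_weight_step[OF Suc.prems] IH
    using side_const_scan_step[OF om, of A "ends (side_of (mirror \<sigma>) (- B))" "map \<sigma> [A + 1 + 1..B - 1]" B] by (simp add: mult_ac)
qed

text \<open>Since the scan vanishes as soon as an occupied site is isolated, it can be summed over
  all words instead of over admissible fillings only.\<close>

lemma scan_nonzero_imp:
  assumes "scan (ends (side_of (mirror \<sigma>) (- B))) (side_of \<sigma> A) (map \<sigma> [A + 1..B - 1]) \<noteq> 0"
    "A < B" "A \<le> x" "x \<le> B" "\<sigma> x"
  shows "\<sigma> (x - 1) \<or> \<sigma> (x + 1)"
  using assms(1-3)
proof (induction "nat (B - A - 1)" arbitrary: A)
  case 0
  then have B: "B = A + 1" by simp
  have m: "mirror \<sigma> (- B) = \<sigma> B" "mirror \<sigma> (- B - 1) = \<sigma> (B + 1)" by (simp_all add: mirror_def add.commute)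
  have E: "ends (side_of (mirror \<sigma>) (- B)) (side_of \<sigma> A) \<noteq> 0" using 0 B by simp
  consider "x = A" | "x = B" using 0 assms(4) B by linarith
  then show ?case
    by cases (use E m assms(5) B in \<open>auto simp: side_of_def split: if_splits\<close>)
next
  case (Suc k)
  then have AB: "A + 1 < B" by simp
  have e: "map \<sigma> [A + 1..B - 1] = \<sigma> (A + 1) # map \<sigma> [A + 1 + 1..B - 1]"
    using AB upto_rec1[of "A + 1" "B - 1"] by simp
  have nz: "scan (ends (side_of (mirror \<sigma>) (- B))) (side_of \<sigma> A) (\<sigma> (A + 1) # map \<sigma> [A + 1 + 1..B - 1]) \<noteq> 0"
    using Suc.prems e by simp
  show ?case
  proof (cases "x = A")
    case True
    then show ?thesis using nz assms(5) by (auto simp: side_of_def split: if_splits)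
  next
    case False
    have "scan (ends (side_of (mirror \<sigma>) (- B))) (side_of \<sigma> (A + 1)) (map \<sigma> [A + 1 + 1..B - 1]) \<noteq> 0"
      using nz side_of_gap_step[of \<sigma> A]
      by (cases "\<sigma> (A + 1)") (auto simp: side_of_def left_dist_occ split: if_splits)
    then show ?thesis using Suc.hyps(1)[of "A + 1"] Suc.hyps(2) Suc.prems AB False by simp
  qed
qed


section \<open>Conditional probabilities and their oscillation\<close>

lemma left_dist_cong: "(\<And>x. x \<le> A \<Longrightarrow> \<sigma> x = \<tau> x) \<Longrightarrow> left_dist \<sigma> A = left_dist \<tau> A"
  unfolding left_dist_def by simp

lemma side_of_cong: "(\<And>x. x \<le> A \<Longrightarrow> \<sigma> x = \<tau> x) \<Longrightarrow> side_of \<sigma> A = side_of \<tau> A"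
  using left_dist_cong[of A \<sigma> \<tau>] unfolding side_of_def by simp

lemma side_const_cong: "(\<And>x. x \<le> A \<Longrightarrow> \<sigma> x = \<tau> x) \<Longrightarrow> side_const \<sigma> A = side_const \<tau> A"
  using left_dist_cong[of A \<sigma> \<tau>] unfolding side_const_def by simp

lemma side_const_pos: "0 < side_const \<sigma> A"
  unfolding side_const_def gap_const_def using p_pos p_less_1 a_neg lam_pos by (auto split: option.split)

lemma small_gap_side_of: "small_gap (side_of \<sigma> A)"
proof -
  have "\<bar>gap_param (left_dist \<sigma> A)\<bar> \<le> - a" if "\<not> \<sigma> A"
  proof (cases "left_dist \<sigma> (A - 1)")
    case None
    then show ?thesis using left_dist_step[of \<sigma> A] that a_neg by simp
  next
    case (Some e)
    have "\<bar>a\<bar> * \<bar>a\<bar> ^ e \<le> \<bar>a\<bar> * 1" using a_neg a_gt by (intro mult_left_mono power_le_one) auto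
    then show ?thesis using left_dist_step[of \<sigma> A] that Some a_neg by (simp add: abs_mult power_abs)
  qed
  then show ?thesis unfolding side_of_def by simp
qed

text \<open>The side constants depend only on \<open>\<eta>\<close> and cancel. The set
  \<open>ext\<close> includes fillings outside \<open>Omega'\<close>, which have scan 0, so that it
  corresponds to all words of the window's length.\<close>

lemma gamma'_eq_ratio:
  assumes lr: "l \<le> r" and eta: "\<eta> \<in> Omega'"
  shows "gamma' p {l..r} \<omega> \<eta> =
    ratio (side_of \<eta> (l - 1)) (side_of (mirror \<eta>) (- (r + 1))) (map \<omega> [l..r])"
proof -
  define s where "s = side_of \<eta> (l - 1)"
  define R where "R = side_of (mirror \<eta>) (- (r + 1))"
  define c where "c = side_const \<eta> (l - 1) * side_const (mirror \<eta>) (- (r + 1))"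
  have c: "0 < c" unfolding c_def by (intro mult_pos_pos side_const_pos)
  define ext where "ext = {\<sigma>. \<forall>x. x \<notin> {l..r} \<longrightarrow> \<sigma> x = \<eta> x}"
  have sides: "side_of \<sigma> (l - 1) = s" "side_of (mirror \<sigma>) (- (r + 1)) = R"
    "side_const \<sigma> (l - 1) * side_const (mirror \<sigma>) (- (r + 1)) = c" if "\<sigma> \<in> ext" for \<sigma>
  proof -
    have L: "\<sigma> x = \<eta> x" if "x \<le> l - 1" for x using \<open>\<sigma> \<in> ext\<close> that unfolding ext_def by auto
    have M: "mirror \<sigma> x = mirror \<eta> x" if "x \<le> - (r + 1)" for x
      using \<open>\<sigma> \<in> ext\<close> that unfolding ext_def mirror_def by auto
    show "side_of \<sigma> (l - 1) = s" unfolding s_def by (rule side_of_cong[OF L])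
    show "side_of (mirror \<sigma>) (- (r + 1)) = R" unfolding R_def by (rule side_of_cong[OF M])
    show "side_const \<sigma> (l - 1) * side_const (mirror \<sigma>) (- (r + 1)) = c"
      unfolding c_def using side_const_cong[OF L] side_const_cong[OF M] by simp
  qed
  have w: "weight p {l..r} \<sigma> = c * scan (ends R) s (map \<sigma> [l..r])" if "\<sigma> \<in> ext" "\<sigma> \<in> Omega'" for \<sigma>
    using window_weight_eq_scan[OF that(2), of "l - 1" "r + 1"] lr weight_eq_window_weight[OF lr] sides[OF that(1)] by simp
  have z: "scan (ends R) s (map \<sigma> [l..r]) = 0" if "\<sigma> \<in> ext" "\<sigma> \<notin> Omega'" for \<sigma>
  proof (rule ccontr)
    assume "scan (ends R) s (map \<sigma> [l..r]) \<noteq> 0"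
    then have nz: "scan (ends (side_of (mirror \<sigma>) (- (r + 1)))) (side_of \<sigma> (l - 1)) (map \<sigma> [l - 1 + 1..r + 1 - 1]) \<noteq> 0"
      using sides[OF that(1)] by simp
    have "\<sigma> (x - 1) \<or> \<sigma> (x + 1)" if "\<sigma> x" for x
    proof (cases "l - 1 \<le> x \<and> x \<le> r + 1")
      case True
      then show ?thesis using scan_nonzero_imp[OF nz _ _ _ that] lr by simp
    next
      case False
      then have "\<sigma> x = \<eta> x" "\<sigma> (x - 1) = \<eta> (x - 1)" "\<sigma> (x + 1) = \<eta> (x + 1)"
        using \<open>\<sigma> \<in> ext\<close> unfolding ext_def by auto
      then show ?thesis using that eta unfolding Omega'_iff by auto
    qed
    then show False using that(2) unfolding Omega'_iff by blast
  qed
  let ?n = "nat (r - l + 1)"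
  have bij: "bij_betw (\<lambda>\<sigma>. map \<sigma> [l..r]) ext {xs. length xs = ?n}"
  proof (rule bij_betw_byWitness[where f' = "\<lambda>xs x. if x \<in> {l..r} then xs ! nat (x - l) else \<eta> x"])
    show "\<forall>\<sigma>\<in>ext. (\<lambda>x. if x \<in> {l..r} then map \<sigma> [l..r] ! nat (x - l) else \<eta> x) = \<sigma>"
      by (auto simp: ext_def fun_eq_iff nth_upto)
    show "\<forall>xs\<in>{xs. length xs = ?n}. map (\<lambda>x. if x \<in> {l..r} then xs ! nat (x - l) else \<eta> x) [l..r] = xs"
      using lr by (auto intro!: nth_equalityI simp: nth_upto)
  qed (auto simp: ext_def)
  have fin: "finite ext" using bij finite_lists_length_eq[of "UNIV :: bool set" ?n] bij_betw_finite by auto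
  have adm: "admissible {l..r} \<eta> = ext \<inter> Omega'" unfolding admissible_def ext_def by auto
  have "Znorm p {l..r} \<eta> = (\<Sum>\<sigma>\<in>ext \<inter> Omega'. c * scan (ends R) s (map \<sigma> [l..r]))"
    unfolding Znorm_def adm using w by (intro sum.cong) auto
  also have "\<dots> = (\<Sum>\<sigma>\<in>ext. c * scan (ends R) s (map \<sigma> [l..r]))"
    using z fin by (intro sum.mono_neutral_left) auto
  also have "\<dots> = c * total R s ?n"
    unfolding total_def sum.reindex_bij_betw[OF bij, symmetric] sum_distrib_left ..
  finally have Z: "Znorm p {l..r} \<eta> = c * total R s ?n" .
  have ext: "concat {l..r} \<omega> \<eta> \<in> ext" unfolding ext_def concat_def by auto
  have m: "map (concat {l..r} \<omega> \<eta>) [l..r] = map \<omega> [l..r]" unfolding concat_def by auto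
  have "gamma' p {l..r} \<omega> \<eta> = c * scan (ends R) s (map \<omega> [l..r]) / (c * total R s ?n)"
    unfolding gamma'_def Z using w[OF ext] z[OF ext] m by auto
  then show ?thesis unfolding ratio_def s_def[symmetric] R_def[symmetric] using c by simp
qed

text \<open>Either the nearest occupied site lies in \<open>{L..A}\<close> and is common to both, or
  both distances are at least \<open>A + 1 - L\<close>, hence at least \<open>n\<close>, or
  infinite.\<close>

lemma near_side_of:
  assumes agree: "\<And>x. L \<le> x \<Longrightarrow> x \<le> A \<Longrightarrow> \<omega> x = \<eta> x" and "L < A" "int n \<le> A + 1 - L"
  shows "near (\<bar>a\<bar> ^ n) (side_of \<omega> A) (side_of \<eta> A)"
proof -
  have a1: "\<omega> A = \<eta> A" "\<omega> (A - 1) = \<eta> (A - 1)" using assms by auto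
  consider (occ) "\<omega> A" | (near) e where "left_dist \<omega> A = Some e" "L \<le> A - int e" | (far) "\<not> \<omega> A" "\<And>z. L \<le> z \<Longrightarrow> z \<le> A \<Longrightarrow> \<not> \<omega> z"
  proof (cases "\<exists>z. L \<le> z \<and> z \<le> A \<and> \<omega> z")
    case True
    then obtain z where z: "L \<le> z" "z \<le> A" "\<omega> z" by auto
    then have "left_dist \<omega> A \<noteq> None" using left_dist_eq_None_iff by blast
    then obtain e where e: "left_dist \<omega> A = Some e" by auto
    then have "z \<le> A - int e" using left_dist_SomeD(2)[OF e, of z] z by force
    then show ?thesis using e z that(2) by auto
  next
    case False
    then show ?thesis using that(3) assms(2) by auto
  qed
  then show ?thesis
  proof cases
    case occ
    then show ?thesis using a1 by (simp add: near_def side_of_def)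
  next
    case (near e)
    have "left_dist \<eta> A = Some e"
    proof (rule left_dist_SomeI)
      show "\<eta> (A - int e)" using left_dist_SomeD(1)[OF near(1)] agree[of "A - int e"] near(2) by simp
      fix z assume "A - int e < z" "z \<le> A"
      then show "\<not> \<eta> z" using left_dist_SomeD(2)[OF near(1), of z] agree[of z] near(2) by simp
    qed
    then show ?thesis using a1 near by (simp add: near_def side_of_def)
  next
    case far
    have small: "\<bar>gap_param (left_dist \<sigma> A)\<bar> \<le> \<bar>a\<bar> ^ n" if "\<And>z. L \<le> z \<Longrightarrow> z \<le> A \<Longrightarrow> \<not> \<sigma> z" for \<sigma>
    proof (cases "left_dist \<sigma> A")
      case (Some e)
      have "\<not> L \<le> A - int e" using that[of "A - int e"] left_dist_SomeD(1)[OF Some] by auto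
      then have "n \<le> e" using assms(3) by linarith
      then show ?thesis unfolding Some using a_neg a_gt by (simp add: power_abs power_decreasing)
    qed simp
    have "\<bar>gap_param (left_dist \<omega> A)\<bar> \<le> \<bar>a\<bar> ^ n" "\<bar>gap_param (left_dist \<eta> A)\<bar> \<le> \<bar>a\<bar> ^ n"
      using far(2) agree by (auto intro!: small)
    then show ?thesis using far(1) a1 by (simp add: near_def side_of_def)
  qed
qed

lemma osc_upper:
  assumes "l \<le> r" "L < l - 1" "r + 1 < R" "\<omega> \<in> Omega'" "\<eta> \<in> Omega'" "\<forall>x\<in>{L..R}. \<omega> x = \<eta> x"
    and n: "n = nat (min (l - L) (R - r))"
  shows "\<bar>gamma' p {l..r} \<omega> \<omega> - gamma' p {l..r} \<omega> \<eta>\<bar>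
    \<le> 24 / (1 - p)\<^sup>2 * b ^ nat (r - l + 1) * \<bar>a\<bar> ^ n"
proof -
  \<comment> \<open>This is what puts the parameters within the range \<open>a\<^sup>2\<close>
    required by \<open>ratio_near\<close>.\<close>
  have n2: "2 \<le> n" unfolding n using assms by simp
  have "\<bar>a\<bar> ^ n \<le> \<bar>a\<bar>\<^sup>2" using n2 a_neg a_gt by (intro power_decreasing) auto
  then have d: "\<bar>a\<bar> ^ n \<le> a\<^sup>2" by simp
  have 1: "near (\<bar>a\<bar> ^ n) (side_of \<omega> (l - 1)) (side_of \<eta> (l - 1))"
    by (rule near_side_of[of L]) (use assms in auto)
  have 2: "near (\<bar>a\<bar> ^ n) (side_of (mirror \<omega>) (- (r + 1))) (side_of (mirror \<eta>) (- (r + 1)))"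
    by (rule near_side_of[of "- R"]) (use assms in \<open>auto simp: mirror_def\<close>)
  have "map \<omega> [l..r] \<noteq> []" using assms by simp
  from ratio_near[OF d 1 2 small_gap_side_of small_gap_side_of this]
  show ?thesis unfolding gamma'_eq_ratio[OF assms(1,4)] gamma'_eq_ratio[OF assms(1,5)] by simp
qed

text \<open>The configurations differ only beyond the end of \<open>{L..R}\<close> that is closer to
  the window; the window and everything on its other side up to that end are occupied or at least
  leave that other side paired.\<close>

lemma osc_lower:
  assumes "l \<le> r" "L < l - 1" "r + 1 < R" and n: "n = nat (min (l - L) (R - r))"
  shows "\<exists>\<omega> \<eta>. \<omega> \<in> Omega' \<and> \<eta> \<in> Omega' \<and> (\<forall>x\<in>{L..R}. \<omega> x = \<eta> x) \<and>
    sqrt (1 - p) / 6 * p ^ nat (r - l + 1) * \<bar>a\<bar> ^ n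
      \<le> \<bar>gamma' p {l..r} \<omega> \<omega> - gamma' p {l..r} \<omega> \<eta>\<bar>"
proof -
  define k where "k = nat (r - l + 1)"
  have k: "0 < k" unfolding k_def using assms by simp
  have ones: "map \<omega> [l..r] = replicate k True" if "\<And>x. l \<le> x \<Longrightarrow> x \<le> r \<Longrightarrow> \<omega> x" for \<omega>
    using that by (intro nth_equalityI) (auto simp: k_def nth_upto)
  show ?thesis
  proof (cases "l - L \<le> R - r")
    case True
    \<comment> \<open>To the left of \<open>l\<close> the nearest occupied site is
      \<open>L - 1\<close>, at distance \<open>l - L = n\<close> from \<open>l - 1\<close>; in
      \<open>\<eta>\<close> there is none.\<close>
    define \<omega> where "\<omega> x = (l \<le> x \<or> x < L)" for x
    define \<eta> where "\<eta> x = (l \<le> x)" for x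
    have om: "\<omega> \<in> Omega'" "\<eta> \<in> Omega'" unfolding Omega'_iff \<omega>_def \<eta>_def by auto
    have "left_dist \<omega> (l - 1) = Some n"
      by (rule left_dist_SomeI) (use True assms in \<open>auto simp: \<omega>_def\<close>)
    then have 1: "side_of \<omega> (l - 1) = Gap (a ^ n)" using assms by (simp add: side_of_def \<omega>_def)
    have "left_dist \<eta> (l - 1) = None" by (simp add: left_dist_eq_None_iff \<eta>_def)
    then have 2: "side_of \<eta> (l - 1) = Gap 0" by (simp add: side_of_def \<eta>_def)
    have 3: "side_of (mirror \<omega>) (- (r + 1)) = Paired" "side_of (mirror \<eta>) (- (r + 1)) = Paired"
      using assms by (auto simp: side_of_def mirror_def \<omega>_def \<eta>_def)
    have m: "map \<omega> [l..r] = replicate k True" by (rule ones) (simp add: \<omega>_def)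
    have "\<forall>x\<in>{L..R}. \<omega> x = \<eta> x" by (auto simp: \<omega>_def \<eta>_def)
    moreover have "sqrt (1 - p) / 6 * p ^ k * \<bar>a\<bar> ^ n
      \<le> \<bar>gamma' p {l..r} \<omega> \<omega> - gamma' p {l..r} \<omega> \<eta>\<bar>"
      unfolding gamma'_eq_ratio[OF assms(1) om(1)] gamma'_eq_ratio[OF assms(1) om(2)] 1 2 3 m ratio_ones[OF k]
      by (rule ones_diff)
    ultimately show ?thesis using om unfolding k_def by blast
  next
    case False
    define \<omega> where "\<omega> x = (x \<le> r \<or> R < x)" for x
    define \<eta> where "\<eta> x = (x \<le> r)" for x
    have om: "\<omega> \<in> Omega'" "\<eta> \<in> Omega'" unfolding Omega'_iff \<omega>_def \<eta>_def by auto
    have "left_dist (mirror \<omega>) (- (r + 1)) = Some n"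
      by (rule left_dist_SomeI) (use False assms in \<open>auto simp: \<omega>_def mirror_def\<close>)
    then have 1: "side_of (mirror \<omega>) (- (r + 1)) = Gap (a ^ n)" using assms by (simp add: side_of_def \<omega>_def mirror_def)
    have "left_dist (mirror \<eta>) (- (r + 1)) = None" by (simp add: left_dist_eq_None_iff \<eta>_def mirror_def)
    then have 2: "side_of (mirror \<eta>) (- (r + 1)) = Gap 0" by (simp add: side_of_def \<eta>_def mirror_def)
    have 3: "side_of \<omega> (l - 1) = Paired" "side_of \<eta> (l - 1) = Paired"
      using assms by (auto simp: side_of_def \<omega>_def \<eta>_def)
    have m: "map \<omega> [l..r] = replicate k True" by (rule ones) (simp add: \<omega>_def)
    have "\<forall>x\<in>{L..R}. \<omega> x = \<eta> x" by (auto simp: \<omega>_def \<eta>_def)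
    moreover have "sqrt (1 - p) / 6 * p ^ k * \<bar>a\<bar> ^ n
      \<le> \<bar>gamma' p {l..r} \<omega> \<omega> - gamma' p {l..r} \<omega> \<eta>\<bar>"
      unfolding gamma'_eq_ratio[OF assms(1) om(1)] gamma'_eq_ratio[OF assms(1) om(2)] 1 2 3 m ratio_ones[OF k]
      by (rule ones_diff)
    ultimately show ?thesis using om unfolding k_def by blast
  qed
qed

end

theorem theorem3p2:
  fixes p :: real and l r L R :: int
  assumes "0 < p" and "p < 1" and "l \<le> r" and "L < l - 1" and "r + 1 < R"
  shows "let n = nat (min (l - L) (R - r));
             a = lambda_r p / lambda_PF p;
             b_minus = p; A_minus = sqrt (1 - p) / 6;
             b_plus = max p (lambda_PF p); A_plus = 24 / (1 - p)^2
         in A_minus * b_minus ^ nat (r - l + 1) * \<bar>a\<bar> ^ n \<le> s_osc p l r L R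
          \<and> s_osc p l r L R \<le> A_plus * b_plus ^ nat (r - l + 1) * \<bar>a\<bar> ^ n"
proof -
  define a where "a = lambda_r p / lambda_PF p"
  define n where "n = nat (min (l - L) (R - r))"
  define M where "M = 24 / (1 - p)^2 * max p (lambda_PF p) ^ nat (r - l + 1) * \<bar>a\<bar> ^ n"
  interpret tbf p "lambda_PF p" a
    by unfold_locales (use assms a_def in auto)
  define S where "S = {\<bar>gamma' p {l..r} \<omega> \<omega> - gamma' p {l..r} \<omega> \<eta>\<bar> | \<omega> \<eta>.
        \<omega> \<in> Omega' \<and> \<eta> \<in> Omega' \<and> (\<forall>x\<in>{L..R}. \<omega> x = \<eta> x)}"
  have up: "x \<le> M" if "x \<in> S" for x
    using that osc_upper[OF assms(3-5) _ _ _ n_def] unfolding S_def M_def b_def by auto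
  obtain x where x: "x \<in> S" "sqrt (1 - p) / 6 * p ^ nat (r - l + 1) * \<bar>a\<bar> ^ n \<le> x"
    using osc_lower[OF assms(3-5) n_def] unfolding S_def by blast
  have "x \<le> Sup S" using x(1) up by (intro cSup_upper bdd_aboveI)
  moreover have "Sup S \<le> M" using x(1) up by (intro cSup_least) auto
  ultimately show ?thesis
    using x(2) unfolding Let_def s_osc_def S_def[symmetric] a_def[symmetric] n_def[symmetric] M_def[symmetric] by simp
qed

end
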